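(* Let $h>0$, $\beta=(0,0,|\beta|)\ne0$, and let $x_1,\dots,x_N\in\mathbb R^3$ be distinct points lying in one plane orthogonal to $\beta$. Let $\varphi:\mathbb R\to\mathbb R$ be a $C^\infty$ function with compact support, equal to $1$ in a neighborhood of $0$, and for $\varepsilon>0$ take the cutoff $\chi(|k|)=\chi_\varepsilon(|k|)=\varphi(\varepsilon|k|)$. For $E\subset\{1,\dots,N\}$ let $\mathbf H_\varepsilon(q_h(a_E),p_h(a_E),\pi_{a_E})$ be the energy of the fixed point of the Hamiltonian system associated with $a_E$ (with cutoff $\chi_\varepsilon$), set $\varepsilon_\lambda=1$ if $\lambda\in E$, $\varepsilon_\lambda=-1$ otherwise, and set $$F_\varepsilon(x)=(2\pi)^{-3}\int_{\mathbb R^3}|\varphi(\varepsilon|k|)|^2\cos(k\cdot x)\frac{k_1^2+k_2^2}{|k|^2}dk,\qquad C_\varepsilon=-\frac{h^2}{2}N F_\varepsilon(0),$$ which does not depend on $E$. Then $$\lim_{\varepsilon\to0}\Big(\mathbf H_\varepsilon(q_h(a_E),p_h(a_E),\pi_{a_E})-C_\varepsilon\Big)=h|\beta|\sum_{\lambda=1}^N\varepsilon_\lambda+\frac{h^2}{8\pi}\sum_{\lambda\ne\mu}\frac{\varepsilon_\lambda\varepsilon_\mu}{|x_\lambda-x_\mu|^3}.$$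
   Context: $H$ is the real Hilbert space of $f=(f_1,f_2,f_3):\mathbb R^3\to\mathbb R^3$ with $f_j\in L^2(\mathbb R^3)$ real valued and $k\cdot f(k)=0$ a.e., with $|f|^2=\sum_j\int|f_j(k)|^2dk$ and scalar product $\cdot$. $M$ is multiplication by $|k|$ in $H$. $(e_1,e_2,e_3)$ is the canonical basis of $\mathbb R^3$; $\wedge$ is the cross product. For a cutoff $\chi$ (here not required to vanish near $0$), $x\in\mathbb R^3$, $m=1,2,3$, $$a_m(x)(k)=\frac{\chi(|k|)|k|^{1/2}}{(2\pi)^{3/2}}\sin(k\cdot x)\frac{k\wedge e_m}{|k|},\qquad b_m(x)(k)=\frac{\chi(|k|)|k|^{1/2}}{(2\pi)^{3/2}}\cos(k\cdot x)\frac{k\wedge e_m}{|k|},$$ and $B_m(x,q,p)=a_m(x)\cdot q+b_m(x)\cdot p$ for $(q,p)\in H^2$. $\mathcal H_{sp}=(\mathbb C^2)^{\otimes N}$; $\sigma_m^{[\lambda]}$ is the Pauli matrix $\sigma_m$ acting on the $\lambda$-th factor. $\mathcal G$ is the Lie algebra of $SU(2^N)=SU(\mathcal H_{sp})$; for a unit vector $a\in\mathcal H_{sp}$, $\pi_a\in\mathcal G^\star$ is $\langle\pi_a,Y\rangle=i^{-1}\langle Ya,a\rangle$. The Hamiltonian function (with cutoff $\chi=\chi_\varepsilon$, denoted $\mathbf H_\varepsilon$) is $$\mathbf H(q,p,\omega)=\tfrac12\int_{\mathbb R^3}|k|(|q(k)|^2+|p(k)|^2)dk+h\sum_{\lambda,m}(\beta_m+B_m(x_\lambda,q,p))\langle\omega,i\sigma_m^{[\lambda]}\rangle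 .$$ The Hamiltonian system is $q'=Mp+h\sum_{\lambda,m}b_m(x_\lambda)\langle\omega,i\sigma_m^{[\lambda]}\rangle$, $p'=-Mq-h\sum_{\lambda,m}a_m(x_\lambda)\langle\omega,i\sigma_m^{[\lambda]}\rangle$, $\frac{d}{dt}\langle\omega,Y\rangle=\sum_{\lambda,m}(\beta_m+B_m(x_\lambda,q,p))\langle\omega,[i\sigma_m^{[\lambda]},Y]\rangle$ for all $Y\in\mathcal G$. For a unit vector $u\in\mathcal H_{sp}$, $(q_h(u),p_h(u))\in H^2$ is defined by $Mq_h(u)=-h\sum_{\lambda,m}a_m(x_\lambda)\langle\sigma_m^{[\lambda]}u,u\rangle$, $Mp_h(u)=-h\sum_{\lambda,m}b_m(x_\lambda)\langle\sigma_m^{[\lambda]}u,u\rangle$. Unit vectors $b_0,b_1\in\mathbb C^2$ satisfy $\sum_m\beta_m\sigma_mb_0=-|\beta|b_0$, $\sum_m\beta_m\sigma_mb_1=|\beta|b_1$, and $a_E=a_1\otimes\cdots\otimes a_N$ with $a_j=b_1$ if $j\in E$, $a_j=b_0$ if $j\notin E$. In the situation of the claim, $(q_h(a_E),p_h(a_E),\pi_{a_E})$ is a fixed point of the system. *)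

theory Defs
  imports "HOL-Analysis.Analysis"
begin

text \<open>The real Hilbert space of the field. Its elements are classes modulo equality almost
  everywhere; they are handled here through representatives, so equations in the space are
  stated almost everywhere.\<close>

definition field_space :: "(real^3 \<Rightarrow> real^3) set" where
  "field_space = {f.
     (\<forall>j. (\<lambda>k. f k $ j) \<in> borel_measurable lebesgue \<and>
          integrable lebesgue (\<lambda>k. (f k $ j)\<^sup>2)) \<and>
     (AE k in lebesgue. k \<bullet> f k = 0)}"

definition field_inner :: "(real^3 \<Rightarrow> real^3) \<Rightarrow> (real^3 \<Rightarrow> real^3) \<Rightarrow> real" where
  "field_inner f g = (\<Sum>j\<in>UNIV. LINT k|lebesgue. f k $ j * g k $ j)"

definition mult_M :: "(real^3 \<Rightarrow> real^3) \<Rightarrow> real^3 \<Rightarrow> real^3" where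
  "mult_M f = (\<lambda>k. norm k *\<^sub>R f k)"

text \<open>The cutoff is passed as the function \<open>r \<mapsto> \<chi>(r)\<close>, applied to \<open>r = |k|\<close>. At \<open>k = 0\<close> the
  fields below take the value \<open>0\<close>.\<close>

definition field_a :: "(real \<Rightarrow> real) \<Rightarrow> 3 \<Rightarrow> real^3 \<Rightarrow> real^3 \<Rightarrow> real^3" where
  "field_a chi m x k =
     (chi (norm k) * norm k powr (1/2) / (2 * pi) powr (3/2) * sin (k \<bullet> x))
       *\<^sub>R (cross3 k (axis m 1) /\<^sub>R norm k)"

definition field_b :: "(real \<Rightarrow> real) \<Rightarrow> 3 \<Rightarrow> real^3 \<Rightarrow> real^3 \<Rightarrow> real^3" where
  "field_b chi m x k =
     (chi (norm k) * norm k powr (1/2) / (2 * pi) powr (3/2) * cos (k \<bullet> x))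
       *\<^sub>R (cross3 k (axis m 1) /\<^sub>R norm k)"

definition field_B ::
  "(real \<Rightarrow> real) \<Rightarrow> 3 \<Rightarrow> real^3 \<Rightarrow> (real^3 \<Rightarrow> real^3) \<Rightarrow> (real^3 \<Rightarrow> real^3) \<Rightarrow> real" where
  "field_B chi m x q p = field_inner (field_a chi m x) q + field_inner (field_b chi m x) p"

text \<open>The spin space: the factors of the \<open>N\<close>-fold tensor product are indexed by a finite type
  \<open>'n\<close> with \<open>N\<close> elements, and \<open>(\<complex>\<^sup>2)\<^sup>\<otimes>\<^sup>N\<close> is the coordinate space over the canonical product basis,
  whose elements are labelled by the functions \<open>'n \<Rightarrow> 2\<close>.\<close>

type_synonym 'n spin = "(complex, 'n \<Rightarrow> 2) vec"
type_synonym 'n spin_op = "((complex, 'n \<Rightarrow> 2) vec, 'n \<Rightarrow> 2) vec"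

definition tensor :: "('n::finite \<Rightarrow> complex^2) \<Rightarrow> 'n spin" where
  "tensor v = (\<chi> s. \<Prod>j\<in>UNIV. v j $ s j)"

text \<open>Hermitian product, linear in the first argument.\<close>

definition herm :: "complex ^ 'd \<Rightarrow> complex ^ 'd \<Rightarrow> complex" where
  "herm u v = (\<Sum>s\<in>UNIV. u $ s * cnj (v $ s))"

definition pauli :: "3 \<Rightarrow> complex^2^2" where
  "pauli m =
    (if m = 1 then vector [vector [0, 1], vector [1, 0]]
     else if m = 2 then vector [vector [0, - \<i>], vector [\<i>, 0]]
     else vector [vector [1, 0], vector [0, -1]])"

definition site_op :: "'n::finite \<Rightarrow> complex^2^2 \<Rightarrow> 'n spin_op" where
  "site_op l A = (\<chi> s t. if \<forall>j. j \<noteq> l \<longrightarrow> s j = t j then A $ s l $ t l else 0)"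

definition sigma :: "3 \<Rightarrow> 'n::finite \<Rightarrow> 'n spin_op" where
  "sigma m l = site_op l (pauli m)"

definition i_sigma :: "3 \<Rightarrow> 'n::finite \<Rightarrow> 'n spin_op" where
  "i_sigma m l = map_matrix (\<lambda>z. \<i> * z) (sigma m l)"

text \<open>The Lie algebra of \<open>SU\<close> of the spin space: traceless skew-Hermitian matrices.\<close>

definition su_alg :: "'n::finite spin_op set" where
  "su_alg = {Y. map_matrix cnj (transpose Y) = - Y \<and> trace Y = 0}"

text \<open>Elements of the dual of the Lie algebra are real functions on \<open>su_alg\<close>, left unspecified
  outside it. For \<open>Y\<close> in \<open>su_alg\<close> the number \<open>\<langle>Ya, a\<rangle> / \<i>\<close> is real.\<close>

definition pi_fun :: "'n::finite spin \<Rightarrow> 'n spin_op \<Rightarrow> real" where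
  "pi_fun a = (\<lambda>Y\<in>su_alg. Re (inverse \<i> * herm (Y *v a) a))"

text \<open>The Hamiltonian function; \<open>\<omega>\<close> is an element of the dual of the Lie algebra.\<close>

definition hamiltonian ::
  "(real \<Rightarrow> real) \<Rightarrow> real \<Rightarrow> real^3 \<Rightarrow> ('n::finite \<Rightarrow> real^3) \<Rightarrow>
   (real^3 \<Rightarrow> real^3) \<Rightarrow> (real^3 \<Rightarrow> real^3) \<Rightarrow> ('n spin_op \<Rightarrow> real) \<Rightarrow> real" where
  "hamiltonian chi h \<beta> x q p \<omega> =
     1/2 * (LINT k|lebesgue. norm k * ((norm (q k))\<^sup>2 + (norm (p k))\<^sup>2))
     + h * (\<Sum>l\<in>UNIV. \<Sum>m\<in>UNIV. (\<beta> $ m + field_B chi m (x l) q p) * \<omega> (i_sigma m l))"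

text \<open>The field part \<open>(q\<^sub>h(u), p\<^sub>h(u))\<close> of the stationary point attached to \<open>u\<close>: the elements of the
  field space solving the defining equations. They are determined up to equality almost
  everywhere, and \<open>SOME\<close> picks a representative. The numbers \<open>\<langle>\<sigma>u, u\<rangle>\<close> are real because the
  Pauli matrices are Hermitian.\<close>

definition q_h ::
  "(real \<Rightarrow> real) \<Rightarrow> real \<Rightarrow> ('n::finite \<Rightarrow> real^3) \<Rightarrow> 'n spin \<Rightarrow> real^3 \<Rightarrow> real^3" where
  "q_h chi h x u = (SOME q. q \<in> field_space \<and>
     (AE k in lebesgue. mult_M q k =
        - h *\<^sub>R (\<Sum>l\<in>UNIV. \<Sum>m\<in>UNIV. Re (herm (sigma m l *v u) u) *\<^sub>R field_a chi m (x l) k)))"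

definition p_h ::
  "(real \<Rightarrow> real) \<Rightarrow> real \<Rightarrow> ('n::finite \<Rightarrow> real^3) \<Rightarrow> 'n spin \<Rightarrow> real^3 \<Rightarrow> real^3" where
  "p_h chi h x u = (SOME p. p \<in> field_space \<and>
     (AE k in lebesgue. mult_M p k =
        - h *\<^sub>R (\<Sum>l\<in>UNIV. \<Sum>m\<in>UNIV. Re (herm (sigma m l *v u) u) *\<^sub>R field_b chi m (x l) k)))"

definition fixed_point_energy ::
  "(real \<Rightarrow> real) \<Rightarrow> real \<Rightarrow> real^3 \<Rightarrow> ('n::finite \<Rightarrow> real^3) \<Rightarrow> 'n spin \<Rightarrow> real" where
  "fixed_point_energy chi h \<beta> x u =
     hamiltonian chi h \<beta> x (q_h chi h x u) (p_h chi h x u) (pi_fun u)"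

text \<open>\<open>a\<^sub>E\<close> and the signs \<open>\<epsilon>\<^sub>\<lambda>\<close>.\<close>

definition a_vec :: "complex^2 \<Rightarrow> complex^2 \<Rightarrow> 'n::finite set \<Rightarrow> 'n spin" where
  "a_vec b0 b1 E = tensor (\<lambda>j. if j \<in> E then b1 else b0)"

definition eps_sign :: "'n set \<Rightarrow> 'n \<Rightarrow> real" where
  "eps_sign E l = (if l \<in> E then 1 else -1)"

definition smooth :: "(real \<Rightarrow> real) \<Rightarrow> bool" where
  "smooth f \<longleftrightarrow> (\<forall>n t. (deriv ^^ n) f field_differentiable at t)"

definition F_eps :: "(real \<Rightarrow> real) \<Rightarrow> real \<Rightarrow> real^3 \<Rightarrow> real" where
  "F_eps \<phi> \<epsilon> x = 1 / (2 * pi) ^ 3 *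
     (LINT k|lebesgue. \<bar>\<phi> (\<epsilon> * norm k)\<bar>\<^sup>2 * cos (k \<bullet> x) *
        (((k $ 1)\<^sup>2 + (k $ 2)\<^sup>2) / (norm k)\<^sup>2))"

end

theory Submission
  imports Defs "HOL-Probability.Sinc_Integral"
begin

text \<open>The spin expectations in the state \<open>a\<^sub>E\<close> are \<open>(0, 0, \<epsilon>\<^sub>\<lambda>)\<close>. Hence the field part of the
  fixed point is an explicit combination of plane waves, and the energy is
  \<open>h |\<beta>| \<Sum>\<^sub>\<lambda> \<epsilon>\<^sub>\<lambda> - h\<^sup>2/2 \<Sum>\<^sub>\<lambda>\<^sub>,\<^sub>\<mu> \<epsilon>\<^sub>\<lambda> \<epsilon>\<^sub>\<mu> F\<^sub>\<epsilon> (x\<^sub>\<lambda> - x\<^sub>\<mu>)\<close>; the diagonal terms make up \<open>C\<^sub>\<epsilon>\<close>.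
  It remains to see that \<open>F\<^sub>\<epsilon> (x)\<close> tends to \<open>-1 / (4 \<pi> |x|\<^sup>3)\<close> for \<open>x \<noteq> 0\<close> orthogonal to
  \<open>e\<^sub>3\<close>. The joint law of \<open>(k \<bullet> x / |x|, |k|)\<close> under Lebesgue measure has density \<open>2 \<pi> \<rho>\<close> on
  \<open>|s| \<le> \<rho>\<close>, which reduces \<open>F\<^sub>\<epsilon>\<close> to a one-dimensional oscillatory integral. Integration by
  parts removes all of it in the limit but the term with \<open>sin (r \<rho>) / \<rho>\<close>, for which the sine
  integral yields \<open>\<pi> / 2\<close>.\<close>

section \<open>Integration over space\<close>

text \<open>Formally the limit of \<open>F_eps\<close> is the Fourier integral of 1 - k_3^2 / |k|^2,
  which away from 0 is the second derivative in x_3 of 1 / (4 pi |x|); on the plane x_3 = 0 this is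
  -1 / (4 pi |x|^3). The obstacle is that the integral without cutoff does not converge: after
  integration over spheres the kernel still grows like \<open>\<rho> * sin (r * \<rho>) / r\<close>.
  The limit is of Abel type. It rests on the smoothness of the cutoff, while its bounded support
  only makes every integral finite at fixed \<open>\<epsilon>\<close>.

  The self-interaction \<open>F_eps \<phi> \<epsilon> 0\<close> has no oscillation and grows without
  bound as \<open>\<epsilon>\<close> tends to 0, whence the subtraction of the constant.

  Constants: (2 pi)^(-3) from \<open>F_eps\<close>, 4 pi from the spheres and -pi / (2 r^3) from the
  sine integral multiply to -1 / (4 pi r^3); the factor -h^2 / 2 of the energy turns this into h^2 /
  (8 pi).\<close>

lemma distr_lborel_orthogonal:
  fixes T :: "real^'n::{finite,wellorder} \<Rightarrow> real^'n::_"
  assumes T: "orthogonal_transformation T"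
  shows "distr lborel borel T = lborel"
proof (rule lborel_eqI[symmetric])
  have [measurable]: "T \<in> borel_measurable borel"
    using T by (intro borel_measurable_continuous_onI linear_continuous_on)
      (simp add: linear_conv_bounded_linear[symmetric] orthogonal_transformation_linear)
  have inv: "orthogonal_transformation (inv T)" and bij: "bij T"
    using T by (auto intro: orthogonal_transformation_inv orthogonal_transformation_bij)
  fix l u :: "real^'n::_"
  assume lu: "\<And>b. b \<in> Basis \<Longrightarrow> l \<bullet> b \<le> u \<bullet> b"
  \<comment> \<open>Orthogonal invariance is applied to images, so the preimage of a box is
    rewritten as its image under the orthogonal map \<open>inv T\<close>. Agreement on boxes then
    determines the measure.\<close>
  have vim: "T -` box l u = inv T ` box l u"
    using bij by (simp add: bij_vimage_eq_inv_image)
  have box: "box l u \<in> lmeasurable"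
    by simp
  have "T -` box l u \<in> sets borel"
    by (rule measurable_sets_borel[where M = borel]) auto
  then have "emeasure (distr lborel borel T) (box l u) = emeasure lebesgue (T -` box l u)"
    by (simp add: emeasure_distr)
  also have "\<dots> = measure lebesgue (inv T ` box l u)"
    unfolding vim using measurable_orthogonal_image[OF inv box]
    by (simp add: emeasure_eq_measure2)
  also have "\<dots> = emeasure lborel (box l u)"
    by (simp add: measure_orthogonal_image[OF inv box] emeasure_eq_measure2[symmetric])
  finally show "emeasure (distr lborel borel T) (box l u) = (\<Prod>b\<in>Basis. (u - l) \<bullet> b)"
    using lu by simp
qed simp

lemma borel_measurable_vec3 [measurable]:
  "(\<lambda>(a, b, c). vector [a, b, c] :: real^3) \<in> borel_measurable borel"
proof (intro borel_measurable_continuous_onI)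
  show "continuous_on UNIV (\<lambda>(a, b, c). vector [a, b, c] :: real^3)"
    unfolding case_prod_unfold vector_def
    by (subst continuous_on_componentwise)
      (auto simp: Basis_vec_def forall_3 inner_axis intro!: continuous_intros)
qed

text \<open>Links \<open>real^3\<close> to an iterated product, on which Fubini separates the first
  coordinate from the plane of the other two.\<close>

lemma distr_lborel_vec3:
  "distr lborel borel (\<lambda>(a, b, c). vector [a, b, c] :: real^3) = (lborel :: (real^3) measure)"
proof (rule lborel_eqI[symmetric])
  fix l u :: "real^3"
  assume lu: "\<And>b. b \<in> Basis \<Longrightarrow> l \<bullet> b \<le> u \<bullet> b"
  have vim: "(\<lambda>(a, b, c). vector [a, b, c] :: real^3) -` box l u
    = box (l$1, l$2, l$3) (u$1, u$2, u$3)"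
    by (auto simp: mem_box_cart forall_3 mem_box Basis_prod_def)
  have "axis i 1 \<in> (Basis :: (real^3) set)" for i
    by simp
  then have lu': "l $ i \<le> u $ i" for i
    using lu[of "axis i 1"] by (simp add: inner_axis)
  have "emeasure (distr lborel borel (\<lambda>(a, b, c). vector [a, b, c] :: real^3)) (box l u)
    = emeasure lborel (box (l$1, l$2, l$3) (u$1, u$2, u$3))"
    by (subst emeasure_distr) (auto simp: vim)
  also have "\<dots> = (u$1 - l$1) * ((u$2 - l$2) * (u$3 - l$3))"
    using lu' by (simp add: emeasure_lborel_box_eq Basis_prod_def)
  also have "\<dots> = (\<Prod>b\<in>Basis. (u - l) \<bullet> b)"
  proof -
    have Basis: "(Basis :: (real^3) set) = range (\<lambda>i. axis i 1)"
      by (auto simp: Basis_vec_def)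
    have "(\<Prod>b\<in>Basis. (u - l) \<bullet> b) = (\<Prod>i\<in>UNIV. (u - l) \<bullet> axis i 1)"
      unfolding Basis by (subst prod.reindex) (auto simp: inj_def axis_eq_axis)
    also have "\<dots> = (u$1 - l$1) * ((u$2 - l$2) * (u$3 - l$3))"
      unfolding UNIV_3 by (simp add: inner_axis)
    finally show ?thesis
      by simp
  qed
  finally show "emeasure (distr lborel borel (\<lambda>(a, b, c). vector [a, b, c] :: real^3)) (box l u)
    = (\<Prod>b\<in>Basis. (u - l) \<bullet> b)" .
qed simp

text \<open>The preimage of \<open>{..<a}\<close> is a disc of squared radius a^2 - s^2, whose area
  pi (a^2 - s^2) has derivative 2 pi a in a. The total mass is infinite, so the comparison runs over
  half-lines, which are stable under intersection and have finite measure.\<close>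

lemma distr_lborel_sqrt_norm:
  fixes s :: real
  shows "distr lborel borel (\<lambda>y::real \<times> real. sqrt (s\<^sup>2 + (norm y)\<^sup>2))
    = density lborel (\<lambda>\<rho>. ennreal (2 * pi * \<rho>) * indicator {\<bar>s\<bar>..} \<rho>)" (is "?L = ?R")
proof (rule measure_eqI_generator_eq[where \<Omega> = UNIV and E = "range lessThan"
      and A = "\<lambda>i. {..<real i}"])
  show "Int_stable (range (lessThan :: real \<Rightarrow> _))"
  proof -
    have "{..<a} \<inter> {..<b} = {..<min a b}" for a b :: real
      by auto
    then show ?thesis
      by (auto simp: Int_stable_def)
  qed
  have "sets (borel :: real measure) = sigma_sets UNIV (range lessThan)"
    by (subst borel_Iio) (simp add: sets_measure_of)
  then show "sets ?L = sigma_sets UNIV (range lessThan)" "sets ?R = sigma_sets UNIV (range lessThan)"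
    by auto
  show "(\<Union>i. {..<real i}) = UNIV"
    using reals_Archimedean2 by auto
  have L: "emeasure ?L {..<a} = (if \<bar>s\<bar> < a then ennreal (pi * (a\<^sup>2 - s\<^sup>2)) else 0)" for a
  proof (cases "\<bar>s\<bar> < a")
    case True
    then have sa: "s\<^sup>2 \<le> a\<^sup>2" and a: "0 < a"
      by (auto simp flip: abs_le_square_iff)
    have "sqrt (s\<^sup>2 + (norm y)\<^sup>2) < a \<longleftrightarrow> norm y < sqrt (a\<^sup>2 - s\<^sup>2)" for y :: "real \<times> real"
    proof -
      have "sqrt (s\<^sup>2 + (norm y)\<^sup>2) < a \<longleftrightarrow> s\<^sup>2 + (norm y)\<^sup>2 < a\<^sup>2"
        using a by (metis abs_of_pos real_sqrt_abs real_sqrt_less_iff)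
      also have "\<dots> \<longleftrightarrow> (norm y)\<^sup>2 < a\<^sup>2 - s\<^sup>2"
        by auto
      also have "\<dots> \<longleftrightarrow> norm y < sqrt (a\<^sup>2 - s\<^sup>2)"
        by (metis abs_norm_cancel real_sqrt_abs real_sqrt_less_iff)
      finally show ?thesis .
    qed
    then have vim: "(\<lambda>y::real \<times> real. sqrt (s\<^sup>2 + (norm y)\<^sup>2)) -` {..<a} = ball 0 (sqrt (a\<^sup>2 - s\<^sup>2))"
      by (auto simp: mem_ball_0)
    have "emeasure ?L {..<a} = emeasure lborel (ball 0 (sqrt (a\<^sup>2 - s\<^sup>2)) :: (real \<times> real) set)"
      by (subst emeasure_distr) (auto simp: vim)
    also have "\<dots> = ennreal (pi * (a\<^sup>2 - s\<^sup>2))"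
      using sa by (subst emeasure_ball) (auto simp: unit_ball_vol_2)
    finally show ?thesis
      using True by simp
  next
    case False
    have "\<not> sqrt (s\<^sup>2 + (norm y)\<^sup>2) < a" for y :: "real \<times> real"
    proof -
      have "\<bar>s\<bar> \<le> sqrt (s\<^sup>2 + (norm y)\<^sup>2)"
        by (rule real_le_rsqrt) simp
      with False show ?thesis
        by linarith
    qed
    then have vim: "(\<lambda>y::real \<times> real. sqrt (s\<^sup>2 + (norm y)\<^sup>2)) -` {..<a} = {}"
      by auto
    show ?thesis
      using False by (subst emeasure_distr) (auto simp: vim)
  qed
  have R: "emeasure ?R {..<a} = (if \<bar>s\<bar> < a then ennreal (pi * (a\<^sup>2 - s\<^sup>2)) else 0)" for a
  proof (cases "\<bar>s\<bar> < a")
    case True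
    have "emeasure ?R {..<a} = (\<integral>\<^sup>+ \<rho>. ennreal (2 * pi * \<rho>) * indicator {\<bar>s\<bar>..a} \<rho> \<partial>lborel)"
      using AE_lborel_singleton[of a]
      by (subst emeasure_density) (auto intro!: nn_integral_cong_AE split: split_indicator)
    also have "\<dots> = pi * a\<^sup>2 - pi * \<bar>s\<bar>\<^sup>2"
      using True
      by (intro nn_integral_FTC_Icc)
        (auto intro!: derivative_eq_intros has_real_derivative_iff_has_vector_derivative[THEN iffD1])
    finally show ?thesis
      using True by (simp add: algebra_simps)
  next
    case False
    have "emeasure ?R {..<a}
      = (\<integral>\<^sup>+ \<rho>. ennreal (2 * pi * \<rho>) * indicator {\<bar>s\<bar>..} \<rho> * indicator {..<a} \<rho> \<partial>lborel)"
      by (simp add: emeasure_density)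
    also have "\<dots> = (\<integral>\<^sup>+ \<rho>. 0 \<partial>(lborel :: real measure))"
      using False by (intro nn_integral_cong) (auto split: split_indicator)
    finally show ?thesis
      using False by simp
  qed
  show "emeasure ?L X = emeasure ?R X" if "X \<in> range lessThan" for X
    using that L R by auto
  show "emeasure ?L {..<real i} \<noteq> \<infinity>" for i
    by (simp add: L)
qed auto

text \<open>In the slice \<open>k $ 1 = s\<close> the norm is
  \<open>sqrt (s\<^sup>2 + (norm y)\<^sup>2)\<close> with \<open>y\<close> in the transverse plane,
  so \<open>distr_lborel_sqrt_norm\<close> gives the law slice by slice.\<close>

lemma distr_lborel_component_norm:
  "distr lborel borel (\<lambda>k::real^3. (k $ 1, norm k))
    = density lborel (\<lambda>p. ennreal (2 * pi * snd p) * indicator {p. \<bar>fst p\<bar> \<le> snd p} p)" (is "?L = ?R")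
proof (rule measure_eqI)
  let ?v = "\<lambda>(a, b, c). vector [a, b, c] :: real^3"
  fix A
  assume "A \<in> sets ?L"
  then have A [measurable]: "A \<in> sets borel"
    by simp
  have v: "?v p $ 1 = fst p" "norm (?v p) = sqrt ((fst p)\<^sup>2 + (norm (snd p))\<^sup>2)" for p
    by (cases p; simp add: norm_vec_def L2_set_def sum_3 norm_Pair)+
  have [measurable]: "{p :: real \<times> real. \<bar>fst p\<bar> \<le> snd p} \<in> sets borel"
    by (intro borel_closed closed_Collect_le continuous_intros)
  have W [measurable]: "(\<lambda>p :: real \<times> real. ennreal (2 * pi * snd p)
      * indicator {p. \<bar>fst p\<bar> \<le> snd p} p) \<in> borel_measurable borel"
    by (intro borel_measurable_times_ennreal measurable_compose[OF _ measurable_ennreal]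
        borel_measurable_indicator borel_measurable_continuous_onI continuous_intros) simp
  have "emeasure ?L A = emeasure (distr (distr lborel borel ?v) borel (\<lambda>k. (k $ 1, norm k))) A"
    by (simp add: distr_lborel_vec3)
  also have "\<dots> = (\<integral>\<^sup>+ k. indicator A (k $ 1, norm k) \<partial>distr lborel borel ?v)"
    by (subst nn_integral_indicator[symmetric], simp, subst nn_integral_distr) auto
  also have "\<dots> = (\<integral>\<^sup>+ p. indicator A (fst p, sqrt ((fst p)\<^sup>2 + (norm (snd p :: real \<times> real))\<^sup>2)) \<partial>lborel)"
    using nn_integral_distr[of ?v lborel borel "\<lambda>k. indicator A (k $ 1, norm k)"] by (simp add: v)
  also have "\<dots> = (\<integral>\<^sup>+ s. \<integral>\<^sup>+ y. indicator A (s, sqrt (s\<^sup>2 + (norm (y::real \<times> real))\<^sup>2)) \<partial>lborel \<partial>lborel)"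
    by (subst lborel_prod[symmetric], subst lborel.nn_integral_fst[symmetric]) auto
  also have "\<dots> = (\<integral>\<^sup>+ s. \<integral>\<^sup>+ \<rho>. indicator A (s, \<rho>)
      \<partial>distr lborel borel (\<lambda>y::real \<times> real. sqrt (s\<^sup>2 + (norm y)\<^sup>2)) \<partial>lborel)"
    by (subst nn_integral_distr) auto
  also have "\<dots> = (\<integral>\<^sup>+ s. \<integral>\<^sup>+ \<rho>. ennreal (2 * pi * \<rho>) * indicator {\<bar>s\<bar>..} \<rho> * indicator A (s, \<rho>)
      \<partial>lborel \<partial>lborel)"
    unfolding distr_lborel_sqrt_norm by (subst nn_integral_density) auto
  also have "\<dots> = (\<integral>\<^sup>+ s. \<integral>\<^sup>+ \<rho>. ennreal (2 * pi * snd (s, \<rho>))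
      * indicator {p. \<bar>fst p\<bar> \<le> snd p} (s, \<rho>) * indicator A (s, \<rho>) \<partial>lborel \<partial>lborel)"
    by (intro nn_integral_cong) (auto split: split_indicator)
  also have "\<dots> = (\<integral>\<^sup>+ p. ennreal (2 * pi * snd p)
      * indicator {p. \<bar>fst p\<bar> \<le> snd p} p * indicator A p \<partial>(lborel \<Otimes>\<^sub>M lborel))"
  proof (rule lborel.nn_integral_fst)
    have "(\<lambda>p. ennreal (2 * pi * snd p) * indicator {p. \<bar>fst p\<bar> \<le> snd p} p * indicator A p)
        \<in> borel_measurable borel"
      by (rule borel_measurable_times_ennreal[OF W borel_measurable_indicator[OF A]])
    then show "(\<lambda>p. ennreal (2 * pi * snd p) * indicator {p. \<bar>fst p\<bar> \<le> snd p} p * indicator A p)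
        \<in> borel_measurable (lborel \<Otimes>\<^sub>M lborel)"
      unfolding lborel_prod by simp
  qed
  also have "\<dots> = emeasure ?R A"
    unfolding lborel_prod using W A by (simp add: emeasure_density)
  finally show "emeasure ?L A = emeasure ?R A" .
qed simp

lemma borel_measurable_cone_weight:
  "(\<lambda>p :: real \<times> real. 2 * pi * snd p * indicator {p. \<bar>fst p\<bar> \<le> snd p} p) \<in> borel_measurable borel"
  by (intro borel_measurable_times borel_measurable_indicator borel_measurable_continuous_onI
      borel_closed closed_Collect_le continuous_intros)

lemma
  fixes g :: "real \<times> real \<Rightarrow> real"
  assumes [measurable]: "g \<in> borel_measurable borel"
  shows integral_component_norm: "(LINT k|lborel. g ((k::real^3) $ 1, norm k))
      = (LINT p|lborel. 2 * pi * snd p * indicator {p. \<bar>fst p\<bar> \<le> snd p} p * g p)" (is "?I")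
    and integrable_component_norm: "integrable lborel (\<lambda>k. g ((k::real^3) $ 1, norm k))
      \<longleftrightarrow> integrable lborel (\<lambda>p. 2 * pi * snd p * indicator {p. \<bar>fst p\<bar> \<le> snd p} p * g p)" (is "?J")
proof -
  note W = borel_measurable_cone_weight
  have "(\<lambda>p::real \<times> real. ennreal (2 * pi * snd p) * indicator {p. \<bar>fst p\<bar> \<le> snd p} p)
    = (\<lambda>p. ennreal (2 * pi * snd p * indicator {p. \<bar>fst p\<bar> \<le> snd p} p))"
    by (auto split: split_indicator)
  then have law: "distr lborel borel (\<lambda>k::real^3. (k $ 1, norm k))
    = density lborel (\<lambda>p. ennreal (2 * pi * snd p * indicator {p. \<bar>fst p\<bar> \<le> snd p} p))"
    using distr_lborel_component_norm by simp
  have "(LINT k|lborel. g ((k::real^3) $ 1, norm k))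
    = (LINT p|distr lborel borel (\<lambda>k::real^3. (k $ 1, norm k)). g p)"
    by (rule integral_distr[symmetric]) auto
  also have "\<dots> = (LINT p|lborel. (2 * pi * snd p * indicator {p. \<bar>fst p\<bar> \<le> snd p} p) *\<^sub>R g p)"
    unfolding law by (rule integral_density) (use W in \<open>auto split: split_indicator\<close>)
  finally show ?I
    by simp
  have "integrable lborel (\<lambda>k. g ((k::real^3) $ 1, norm k))
    \<longleftrightarrow> integrable (distr lborel borel (\<lambda>k::real^3. (k $ 1, norm k))) g"
    by (rule integrable_distr_eq[symmetric]) auto
  also have "\<dots> \<longleftrightarrow> integrable lborel (\<lambda>p. (2 * pi * snd p * indicator {p. \<bar>fst p\<bar> \<le> snd p} p) *\<^sub>R g p)"
    unfolding law by (rule integrable_density) (use W in \<open>auto split: split_indicator\<close>)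
  finally show ?J
    by simp
qed

section \<open>Reduction of the spatial integral to a radial one\<close>

definition plane_rotation :: "real \<Rightarrow> real \<Rightarrow> real^3 \<Rightarrow> real^3" where
  "plane_rotation a b y = vector [a * y $ 1 - b * y $ 2, b * y $ 1 + a * y $ 2, y $ 3]"

definition swap_coords :: "real^3 \<Rightarrow> real^3" where
  "swap_coords y = vector [y $ 1, y $ 3, y $ 2]"

lemma norm_vec3_sq: "(norm (y::real^3))\<^sup>2 = (y $ 1)\<^sup>2 + (y $ 2)\<^sup>2 + (y $ 3)\<^sup>2"
  by (simp add: norm_vec_def L2_set_def sum_3)

lemma orthogonal_transformation_plane_rotation:
  assumes "a\<^sup>2 + b\<^sup>2 = 1"
  shows "orthogonal_transformation (plane_rotation a b)"
  unfolding orthogonal_transformation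
proof (intro conjI allI)
  show "linear (plane_rotation a b)"
    by (rule linearI) (auto simp: plane_rotation_def vec_eq_iff forall_3 algebra_simps)
  fix v
  have "(norm (plane_rotation a b v))\<^sup>2 = (a\<^sup>2 + b\<^sup>2) * ((v $ 1)\<^sup>2 + (v $ 2)\<^sup>2) + (v $ 3)\<^sup>2"
    unfolding norm_vec3_sq plane_rotation_def by (simp add: power2_eq_square algebra_simps)
  then show "norm (plane_rotation a b v) = norm v"
    using assms norm_vec3_sq[of v] by (intro power2_eq_imp_eq[of "norm _"]) simp_all
qed

lemma orthogonal_transformation_swap_coords: "orthogonal_transformation swap_coords"
  unfolding orthogonal_transformation
proof (intro conjI allI)
  show "linear swap_coords"
    by (rule linearI) (auto simp: swap_coords_def vec_eq_iff forall_3)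
  show "norm (swap_coords v) = norm v" for v
    by (rule power2_eq_imp_eq) (simp_all add: norm_vec3_sq swap_coords_def)
qed

lemma integral_lborel_orthogonal:
  fixes T :: "real^'n::{finite,wellorder} \<Rightarrow> real^'n::_" and f :: "real^'n::_ \<Rightarrow> real"
  assumes T: "orthogonal_transformation T" and [measurable]: "f \<in> borel_measurable borel"
  shows "(LINT k|lborel. f (T k)) = (LINT k|lborel. f k)"
proof -
  have [measurable]: "T \<in> borel_measurable borel"
    using T by (intro borel_measurable_continuous_onI linear_continuous_on)
      (simp add: linear_conv_bounded_linear[symmetric] orthogonal_transformation_linear)
  have "(LINT k|lborel. f k) = (LINT k|distr lborel borel T. f k)"
    by (simp add: distr_lborel_orthogonal[OF T])
  then show ?thesis
    by (simp add: integral_distr)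
qed

lemma integrable_lborel_bounded_support:
  fixes f :: "'a::euclidean_space \<Rightarrow> real"
  assumes "f \<in> borel_measurable borel"
    and "\<And>k. \<bar>f k\<bar> \<le> C" "\<And>k. R < norm k \<Longrightarrow> f k = 0"
  shows "integrable lborel f"
proof (rule integrableI_bounded_set[where A = "cball 0 R" and B = C])
  show "emeasure lborel (cball (0::'a) R) < \<infinity>"
    by (simp add: emeasure_lborel_cball_finite infinity_ennreal_def[symmetric] del: infinity_ennreal_def)
qed (use assms in auto)

text \<open>The function below is the integral of \<open>cos (k \<bullet> x) (k\<^sub>1\<^sup>2 + k\<^sub>2\<^sup>2) / |k|\<^sup>2\<close> over the sphere of
  radius \<open>\<rho>\<close>, divided by \<open>4 \<pi>\<close>, for \<open>x\<close> orthogonal to \<open>e\<^sub>3\<close> and \<open>r = |x|\<close>.\<close>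

definition field_kernel :: "real \<Rightarrow> real \<Rightarrow> real" where
  "field_kernel r \<rho> = \<rho> * sin (r * \<rho>) / r + (cos (r * \<rho>) - sinc (r * \<rho>)) / r\<^sup>2"

text \<open>With s = k_1 and \<open>\<rho>\<close> = |k|, the mean of k_2^2 over the circle of such
  k is (\<open>\<rho>\<^sup>2 - s\<^sup>2\<close>) / 2, so the polynomial factor is the mean of
  (k_1^2 + k_2^2) / |k|^2 over that circle.\<close>

lemma integral_angular:
  fixes r \<rho> :: real
  assumes "r \<noteq> 0" "0 < \<rho>"
  shows "(LINT s|lborel. cos (r * s) * ((\<rho>\<^sup>2 + s\<^sup>2) / (2 * \<rho>\<^sup>2)) * indicator {- \<rho>..\<rho>} s)
    = 2 * field_kernel r \<rho> / \<rho>"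
proof -
  \<comment> \<open>Obtained by integrating the quadratic polynomial against the cosine by parts
    twice.\<close>
  define F where "F s = ((\<rho>\<^sup>2 + s\<^sup>2) * sin (r * s) / r + 2 * s * cos (r * s) / r\<^sup>2
      - 2 * sin (r * s) / r ^ 3) / (2 * \<rho>\<^sup>2)" for s
  have "(F has_real_derivative cos (r * s) * ((\<rho>\<^sup>2 + s\<^sup>2) / (2 * \<rho>\<^sup>2))) (at s)" for s
    unfolding F_def using assms
    by (auto intro!: derivative_eq_intros) (simp add: field_simps eval_nat_numeral)
  then have "(LINT s|lborel. cos (r * s) * ((\<rho>\<^sup>2 + s\<^sup>2) / (2 * \<rho>\<^sup>2)) * indicator {- \<rho>..\<rho>} s)
    = F \<rho> - F (- \<rho>)"
    using assms by (intro integral_FTC_Icc_real) (auto intro!: continuous_intros)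
  also have "\<dots> = 2 * field_kernel r \<rho> / \<rho>"
    using assms unfolding F_def field_kernel_def
    by (simp add: field_simps power2_eq_square power3_eq_cube)
  finally show ?thesis .
qed

text \<open>The cutoff is evaluated at radii and its support is bounded on the right, so compactness
  of \<open>{0..R}\<close> yields a bound on the half-line.\<close>

lemma cutoff_bound:
  fixes \<psi> :: "real \<Rightarrow> real"
  assumes cont: "continuous_on UNIV \<psi>" and supp: "\<And>t. R < t \<Longrightarrow> \<psi> t = 0"
  obtains B where "\<And>t. 0 \<le> t \<Longrightarrow> \<bar>\<psi> t\<bar> \<le> B"
proof -
  have "bounded (\<psi> ` {0..R})"
    by (intro compact_imp_bounded compact_continuous_image continuous_on_subset[OF cont]) auto
  then obtain B where B: "\<forall>y\<in>\<psi> ` {0..R}. norm y \<le> B"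
    unfolding bounded_iff by blast
  have "\<bar>\<psi> t\<bar> \<le> max 0 B" if "0 \<le> t" for t
  proof (cases "t \<le> R")
    case True
    then have "norm (\<psi> t) \<le> B"
      using B that by auto
    then show ?thesis
      by simp
  qed (simp add: supp)
  then show ?thesis
    by (rule that)
qed

text \<open>The integrand depends on k only through \<open>k $ 1\<close> and \<open>norm k\<close>,
  so it can be integrated over the cone |s| <= \<open>\<rho>\<close>, with s first. The density 2 pi
  \<open>\<rho>\<close> times the factor 2 / \<open>\<rho>\<close> of
  \<open>integral_angular\<close> gives 4 pi.\<close>

lemma integral_axial:
  fixes \<psi> :: "real \<Rightarrow> real"
  assumes r: "r \<noteq> 0" and R: "0 \<le> R" and cont: "continuous_on UNIV \<psi>"
    and supp: "\<And>t. R < t \<Longrightarrow> \<psi> t = 0"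
  shows "(LINT k|lborel. \<psi> (norm k) * cos (r * (k::real^3) $ 1)
      * (((norm k)\<^sup>2 + (k $ 1)\<^sup>2) / (2 * (norm k)\<^sup>2)))
    = 4 * pi * integral {0..R} (\<lambda>\<rho>. \<psi> \<rho> * field_kernel r \<rho>)"
proof -
  have [measurable]: "\<psi> \<in> borel_measurable borel"
    using cont by (rule borel_measurable_continuous_onI)
  note W = borel_measurable_cone_weight
  obtain B where B: "\<And>t. 0 \<le> t \<Longrightarrow> \<bar>\<psi> t\<bar> \<le> B"
    using cutoff_bound[OF cont supp] by blast
  define g where "g s \<rho> = \<psi> \<rho> * cos (r * s) * ((\<rho>\<^sup>2 + s\<^sup>2) / (2 * \<rho>\<^sup>2))" for s \<rho>
  define G where "G s \<rho> = 2 * pi * \<rho> * indicator {p. \<bar>fst p\<bar> \<le> snd p} (s, \<rho>) * g s \<rho>" for s \<rho>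
  have "(\<lambda>p. g (fst p) (snd p)) \<in> borel_measurable (borel \<Otimes>\<^sub>M borel)"
    unfolding g_def by measurable
  then have g_meas: "(\<lambda>p. g (fst p) (snd p)) \<in> borel_measurable borel"
    by (simp add: borel_prod)
  have G_meas [measurable]: "case_prod G \<in> borel_measurable borel"
    unfolding G_def case_prod_unfold prod.collapse
    by (rule borel_measurable_times[OF W g_meas])
  have int: "integrable lborel (case_prod G)"
  proof (rule integrable_lborel_bounded_support[where C = "2 * pi * R * B" and R = "2 * R"])
    \<comment> \<open>Where |s| <= \<open>\<rho>\<close> <= R the angular factor is at most 1 and
      the weight at most 2 pi R; elsewhere \<open>G\<close> vanishes. That region lies in the ball
      of radius 2 R.\<close>
    have bound: "\<bar>G s \<rho>\<bar> \<le> 2 * pi * R * B" for s \<rho>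
    proof (cases "\<bar>s\<bar> \<le> \<rho> \<and> \<rho> \<le> R")
      case True
      then have \<rho>: "0 \<le> \<rho>" "\<rho> \<le> R" and "s\<^sup>2 \<le> \<rho>\<^sup>2"
        by (auto simp flip: abs_le_square_iff)
      then have "\<bar>(\<rho>\<^sup>2 + s\<^sup>2) / (2 * \<rho>\<^sup>2)\<bar> \<le> 1"
        by (auto simp: divide_le_eq_1)
      then have "\<bar>cos (r * s)\<bar> * \<bar>(\<rho>\<^sup>2 + s\<^sup>2) / (2 * \<rho>\<^sup>2)\<bar> \<le> 1 * 1"
        by (intro mult_mono) auto
      then have "\<bar>\<psi> \<rho>\<bar> * (\<bar>cos (r * s)\<bar> * \<bar>(\<rho>\<^sup>2 + s\<^sup>2) / (2 * \<rho>\<^sup>2)\<bar>) \<le> B * 1"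
        using B[of \<rho>] \<rho> by (intro mult_mono) auto
      then have "\<bar>g s \<rho>\<bar> \<le> B"
        by (simp add: g_def abs_mult mult.assoc)
      then have "\<bar>2 * pi * \<rho>\<bar> * \<bar>g s \<rho>\<bar> \<le> 2 * pi * R * B"
        using \<rho> R by (intro mult_mono) auto
      with True show ?thesis
        by (simp add: G_def abs_mult)
    next
      case False
      moreover have "0 \<le> 2 * pi * R * B"
        using B[of 0] R by (intro mult_nonneg_nonneg) auto
      ultimately show ?thesis
        using supp[of \<rho>] by (auto simp: G_def g_def)
    qed
    then show "\<bar>case_prod G p\<bar> \<le> 2 * pi * R * B" for p
      by (cases p) auto
    have "G s \<rho> = 0" if "2 * R < norm (s, \<rho>)" for s \<rho>
    proof -
      have "norm (s, \<rho>) \<le> \<bar>s\<bar> + \<bar>\<rho>\<bar>"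
        using norm_Pair_le[of s \<rho>] by simp
      with that have "\<not> \<bar>s\<bar> \<le> \<rho> \<or> R < \<rho>"
        by linarith
      then show ?thesis
        using supp[of \<rho>] by (auto simp: G_def g_def)
    qed
    then show "case_prod G p = 0" if "2 * R < norm p" for p
      using that by (cases p) auto
  qed fact
  have inner: "(LINT s|lborel. G s \<rho>) = indicator {0..R} \<rho> *\<^sub>R (4 * pi * (\<psi> \<rho> * field_kernel r \<rho>))" for \<rho>
  proof (cases "0 < \<rho>")
    case True
    have "(LINT s|lborel. G s \<rho>) = (LINT s|lborel. 2 * pi * \<rho> * \<psi> \<rho>
        * (cos (r * s) * ((\<rho>\<^sup>2 + s\<^sup>2) / (2 * \<rho>\<^sup>2)) * indicator {- \<rho>..\<rho>} s))"
      by (intro Bochner_Integration.integral_cong) (auto simp: G_def g_def split: split_indicator)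
    also have "\<dots> = 2 * pi * \<rho> * \<psi> \<rho> * (2 * field_kernel r \<rho> / \<rho>)"
      by (simp only: integral_mult_right_zero integral_angular[OF r True])
    finally show ?thesis
      using True supp[of \<rho>] by (auto split: split_indicator)
  next
    case False
    \<comment> \<open>At \<open>\<rho> = 0\<close> the right-hand side vanishes too, because
      \<open>sinc 0 = 1\<close> makes \<open>field_kernel r 0\<close> zero.\<close>
    then have "G s \<rho> = 0" for s
      by (auto simp: G_def split: split_indicator)
    then show ?thesis
      using False by (auto simp: field_kernel_def split: split_indicator)
  qed
  have "(LINT k|lborel. \<psi> (norm k) * cos (r * (k::real^3) $ 1)
      * (((norm k)\<^sup>2 + (k $ 1)\<^sup>2) / (2 * (norm k)\<^sup>2)))
    = (LINT p|lborel. 2 * pi * snd p * indicator {p. \<bar>fst p\<bar> \<le> snd p} p * case_prod g p)"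
    using integral_component_norm[of "case_prod g"] g_meas
    by (simp add: g_def case_prod_unfold)
  also have "\<dots> = (LINT p|(lborel \<Otimes>\<^sub>M lborel). case_prod G p)"
    by (simp add: lborel_prod G_def case_prod_unfold)
  also have "\<dots> = (LINT \<rho>|lborel. LINT s|lborel. G s \<rho>)"
    using int by (intro lborel_pair.integral_snd[symmetric]) (simp add: lborel_prod)
  also have "\<dots> = (LINT \<rho>:{0..R}|lborel. 4 * pi * (\<psi> \<rho> * field_kernel r \<rho>))"
    by (simp only: inner set_lebesgue_integral_def)
  also have "\<dots> = integral {0..R} (\<lambda>\<rho>. 4 * pi * (\<psi> \<rho> * field_kernel r \<rho>))"
  proof (rule set_borel_integral_eq_integral(2))
    show "set_integrable lborel {0..R} (\<lambda>\<rho>. 4 * pi * (\<psi> \<rho> * field_kernel r \<rho>))"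
      unfolding field_kernel_def using r
      by (intro borel_integrable_atLeastAtMost' continuous_intros continuous_on_subset[OF cont]) auto
  qed
  finally show ?thesis
    by simp
qed

text \<open>As x is orthogonal to e_3, a rotation about e_3 takes e_1 to x / |x| and leaves k_1^2 +
  k_2^2 unchanged. What remains depends on k_2 separately; exchanging the second and third
  coordinates preserves the integral, and adding both versions replaces the numerator by |k|^2 +
  k_1^2.\<close>

lemma integral_planar:
  fixes \<psi> :: "real \<Rightarrow> real" and x :: "real^3"
  assumes x: "x $ 3 = 0" "x \<noteq> 0" and R: "0 \<le> R" and cont: "continuous_on UNIV \<psi>"
    and supp: "\<And>t. R < t \<Longrightarrow> \<psi> t = 0"
  shows "(LINT k|lborel. \<psi> (norm k) * cos (k \<bullet> x) * (((k $ 1)\<^sup>2 + (k $ 2)\<^sup>2) / (norm k)\<^sup>2))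
    = 4 * pi * integral {0..R} (\<lambda>\<rho>. \<psi> \<rho> * field_kernel (norm x) \<rho>)"
proof -
  have [measurable]: "\<psi> \<in> borel_measurable borel"
    using cont by (rule borel_measurable_continuous_onI)
  define r where "r = norm x"
  have r: "r \<noteq> 0"
    using x by (simp add: r_def)
  obtain B where B: "\<And>t. 0 \<le> t \<Longrightarrow> \<bar>\<psi> t\<bar> \<le> B"
    using cutoff_bound[OF cont supp] by blast
  define T where "T = plane_rotation (x $ 1 / r) (x $ 2 / r)"
  have x12: "(x $ 1)\<^sup>2 + (x $ 2)\<^sup>2 = r\<^sup>2"
    using x by (simp add: r_def norm_vec3_sq)
  have ab: "(x $ 1 / r)\<^sup>2 + (x $ 2 / r)\<^sup>2 = 1"
    using r by (simp add: power_divide x12 flip: add_divide_distrib)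
  have T: "orthogonal_transformation T"
    unfolding T_def using ab by (rule orthogonal_transformation_plane_rotation)
  have Tn: "norm (T y) = norm y" for y
    using T by (simp add: orthogonal_transformation)
  have Sn: "norm (swap_coords y) = norm y" for y
    using orthogonal_transformation_swap_coords by (simp add: orthogonal_transformation)
  have Tx: "T y \<bullet> x = r * y $ 1" for y
  proof -
    have "T y \<bullet> x = ((x $ 1)\<^sup>2 + (x $ 2)\<^sup>2) / r * y $ 1"
      using x r by (simp add: T_def plane_rotation_def inner_vec_def sum_3 field_simps power2_eq_square)
    then show ?thesis
      unfolding x12 using r by (simp add: power2_eq_square)
  qed
  have T12: "(T y $ 1)\<^sup>2 + (T y $ 2)\<^sup>2 = (y $ 1)\<^sup>2 + (y $ 2)\<^sup>2" for y
  proof -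
    have "(T y $ 1)\<^sup>2 + (T y $ 2)\<^sup>2 = ((x $ 1 / r)\<^sup>2 + (x $ 2 / r)\<^sup>2) * ((y $ 1)\<^sup>2 + (y $ 2)\<^sup>2)"
      unfolding T_def plane_rotation_def by (simp add: power2_eq_square algebra_simps)
    then show ?thesis
      unfolding ab by simp
  qed
  define f where "f k = \<psi> (norm k) * cos (k \<bullet> x) * (((k $ 1)\<^sup>2 + (k $ 2)\<^sup>2) / (norm k)\<^sup>2)" for k
  have [measurable]: "f \<in> borel_measurable borel"
    unfolding f_def by measurable
  define u where "u i y = \<psi> (norm y) * cos (r * y $ 1) * (((y $ 1)\<^sup>2 + (y $ i)\<^sup>2) / (norm y)\<^sup>2)"
    for i and y :: "real^3"
  have u_meas [measurable]: "u i \<in> borel_measurable borel" for i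
    unfolding u_def by measurable
  \<comment> \<open>Both halves must be integrable for the integral of their sum to split. For an
    index other than 1 the angular factor is at most 1.\<close>
  have u_int: "integrable lborel (u i)" if "i \<noteq> 1" for i
  proof (rule integrable_lborel_bounded_support[where C = B and R = R])
    fix y :: "real^3"
    have "(y $ 1)\<^sup>2 + (y $ i)\<^sup>2 \<le> (norm y)\<^sup>2"
      using that exhaust_3[of i] by (auto simp: norm_vec3_sq)
    then have "\<bar>((y $ 1)\<^sup>2 + (y $ i)\<^sup>2) / (norm y)\<^sup>2\<bar> \<le> 1"
      by (auto simp: divide_le_eq_1)
    then have "\<bar>cos (r * y $ 1)\<bar> * \<bar>((y $ 1)\<^sup>2 + (y $ i)\<^sup>2) / (norm y)\<^sup>2\<bar> \<le> 1 * 1"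
      by (intro mult_mono) auto
    then have "\<bar>\<psi> (norm y)\<bar> * (\<bar>cos (r * y $ 1)\<bar> * \<bar>((y $ 1)\<^sup>2 + (y $ i)\<^sup>2) / (norm y)\<^sup>2\<bar>) \<le> B * 1"
      using B[of "norm y"] by (intro mult_mono) auto
    then show "\<bar>u i y\<bar> \<le> B"
      by (simp add: u_def abs_mult mult.assoc)
  qed (use supp in \<open>auto simp: u_def\<close>)
  have "(LINT k|lborel. f k) = (LINT y|lborel. u 2 y)"
    using integral_lborel_orthogonal[OF T, of f]
    by (simp add: f_def u_def Tn Tx T12)
  moreover have "(LINT y|lborel. u 2 y) = (LINT y|lborel. u 3 y)"
    using integral_lborel_orthogonal[OF orthogonal_transformation_swap_coords u_meas, of 2]
    by (simp add: u_def Sn) (simp add: swap_coords_def)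
  \<comment> \<open>Averaging over the two rotations makes the integrand depend on \<open>y\<close> only through
    \<open>y $ 1\<close> and \<open>norm y\<close>.\<close>
  ultimately have "2 * (LINT k|lborel. f k) = (LINT y|lborel. u 2 y + u 3 y)"
    using u_int by simp
  also have "\<dots> = (LINT y|lborel. 2 * (\<psi> (norm y) * cos (r * (y::real^3) $ 1)
      * (((norm y)\<^sup>2 + (y $ 1)\<^sup>2) / (2 * (norm y)\<^sup>2))))"
  proof (rule Bochner_Integration.integral_cong[OF refl])
    fix y :: "real^3"
    have "((y $ 1)\<^sup>2 + (y $ 2)\<^sup>2) / (norm y)\<^sup>2 + ((y $ 1)\<^sup>2 + (y $ 3)\<^sup>2) / (norm y)\<^sup>2
      = 2 * (((norm y)\<^sup>2 + (y $ 1)\<^sup>2) / (2 * (norm y)\<^sup>2))"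
    proof -
      have "2 * (z / (2 * n)) = z / n" for z n :: real
        by simp
      then show ?thesis
        by (simp only: flip: add_divide_distrib) (simp add: norm_vec3_sq[of y])
    qed
    then show "u 2 y + u 3 y = 2 * (\<psi> (norm y) * cos (r * y $ 1)
      * (((norm y)\<^sup>2 + (y $ 1)\<^sup>2) / (2 * (norm y)\<^sup>2)))"
      unfolding u_def distrib_left[symmetric] by (simp only: mult_ac)
  qed
  also have "\<dots> = 2 * (4 * pi * integral {0..R} (\<lambda>\<rho>. \<psi> \<rho> * field_kernel r \<rho>))"
    by (simp only: integral_mult_right_zero integral_axial[OF r R cont supp])
  finally show ?thesis
    by (simp add: f_def r_def)
qed

section \<open>The oscillatory integral\<close>

text \<open>\<open>f\<close> will be a derivative of the dilated cutoff and \<open>K\<close> an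
  antiderivative of the oscillating factor. At the right end the support kills the boundary term; at
  0 either factor may do so.\<close>

lemma integral_by_parts_vanishing:
  fixes f f' K k :: "real \<Rightarrow> real"
  assumes "a \<le> b"
    and f: "\<And>t. (f has_real_derivative f' t) (at t)"
    and K: "\<And>t. (K has_real_derivative k t) (at t)"
    and cont: "continuous_on UNIV f'" "continuous_on UNIV k"
    and "f a * K a = 0" "f b * K b = 0"
  shows "integral {a..b} (\<lambda>t. f t * k t) = - integral {a..b} (\<lambda>t. f' t * K t)"
proof -
  have "((\<lambda>t. f t * k t + f' t * K t) has_integral (f b * K b - f a * K a)) {a..b}"
  proof (rule fundamental_theorem_of_calculus)
    fix t
    have "((\<lambda>t. f t * K t) has_real_derivative (f t * k t + f' t * K t)) (at t)"
      by (rule derivative_eq_intros f K refl)+ (simp add: mult.commute)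
    then show "((\<lambda>t. f t * K t) has_vector_derivative (f t * k t + f' t * K t)) (at t within {a..b})"
      by (simp add: has_real_derivative_iff_has_vector_derivative has_vector_derivative_at_within)
  qed fact
  then have "integral {a..b} (\<lambda>t. f t * k t + f' t * K t) = 0"
    using assms by (simp add: integral_unique)
  moreover have "continuous_on {a..b} f" "continuous_on {a..b} K"
    using f K by (auto intro!: continuous_at_imp_continuous_on intro: DERIV_isCont)
  then have "(\<lambda>t. f t * k t) integrable_on {a..b}" "(\<lambda>t. f' t * K t) integrable_on {a..b}"
    by (auto intro!: integrable_continuous_real continuous_intros
        intro: continuous_on_subset[OF cont(1)] continuous_on_subset[OF cont(2)])
  ultimately show ?thesis
    by (simp add: Henstock_Kurzweil_Integration.integral_add)
qed

lemma has_real_derivative_dilation: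
  assumes "\<And>t. (f has_real_derivative f' t) (at t)"
  shows "((\<lambda>t. c * f (\<epsilon> * t)) has_real_derivative c * \<epsilon> * f' (\<epsilon> * t)) (at t)"
  by (rule derivative_eq_intros DERIV_chain2[where f = f, OF assms] refl)+ simp

text \<open>\<open>\<psi>\<close> stands for the square of the physical cutoff. Three derivatives
  are carried along because three integrations by parts are made; the support is bounded on the
  right since the arguments are \<open>\<epsilon> * \<rho>\<close> with \<open>\<rho>\<close>
  nonnegative.\<close>

locale cutoff =
  fixes \<psi> \<psi>' \<psi>'' \<psi>''' :: "real \<Rightarrow> real" and \<delta> R :: real
  assumes deriv: "(\<psi> has_real_derivative \<psi>' t) (at t)"
      "(\<psi>' has_real_derivative \<psi>'' t) (at t)"
      "(\<psi>'' has_real_derivative \<psi>''' t) (at t)"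
    and cont: "continuous_on UNIV \<psi>'''"
    and \<delta>: "0 < \<delta>" and R: "0 < R"
    and near_0: "\<bar>t\<bar> < \<delta> \<Longrightarrow> \<psi> t = 1"
    and supp: "R \<le> t \<Longrightarrow> \<psi> t = 0" "R \<le> t \<Longrightarrow> \<psi>' t = 0" "R \<le> t \<Longrightarrow> \<psi>'' t = 0"
      "R \<le> t \<Longrightarrow> \<psi>''' t = 0"
begin

lemma derivs_near_0:
  assumes "\<bar>t\<bar> < \<delta>"
  shows "\<psi>' t = 0" "\<psi>'' t = 0"
proof -
  have *: "\<psi>' u = 0" if "\<bar>u\<bar> < \<delta>" for u
  proof -
    have "((\<lambda>_. 1) has_real_derivative \<psi>' u) (at u)"
      by (rule has_field_derivative_transform_within_open[OF deriv(1), of "{- \<delta><..<\<delta>}"])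
        (use that near_0 in auto)
    then show ?thesis
      using DERIV_const DERIV_unique by blast
  qed
  then show "\<psi>' t = 0"
    using assms .
  have "((\<lambda>_. 0) has_real_derivative \<psi>'' t) (at t)"
    by (rule has_field_derivative_transform_within_open[OF deriv(2), of "{- \<delta><..<\<delta>}"])
      (use assms * in auto)
  then show "\<psi>'' t = 0"
    using DERIV_const DERIV_unique by blast
qed

lemma continuous: "continuous_on UNIV \<psi>" "continuous_on UNIV \<psi>'" "continuous_on UNIV \<psi>''"
  using deriv by (auto intro!: continuous_at_imp_continuous_on intro: DERIV_isCont)

text \<open>Each integration by parts gains a factor \<open>\<epsilon>\<close> from the dilated
  cutoff. The interval has length \<open>R / \<epsilon>\<close> and the oscillating antiderivatives
  have size of order 1 / \<open>\<epsilon>\<close> on it, so two powers only balance and the third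
  makes the contribution vanish. For the part \<open>S\<close>, which converges at infinity, one
  integration by parts is enough: \<open>\<epsilon> * \<psi>' (\<epsilon> * \<rho>)\<close> has
  total integral -1 and is supported where \<open>\<rho>\<close> >=
  \<open>\<delta> / \<epsilon>\<close>, so only the limit of \<open>S\<close> is seen.\<close>

lemma kernel_limit:
  assumes r: "0 < r"
  shows "((\<lambda>\<epsilon>. integral {0..R / \<epsilon>} (\<lambda>\<rho>. \<psi> (\<epsilon> * \<rho>) * field_kernel r \<rho>))
    \<longlongrightarrow> - pi / (2 * r ^ 3)) (at_right 0)"
proof -
  \<comment> \<open>\<open>L0 - S\<close> is an antiderivative of the kernel; \<open>L1\<close> and \<open>L2\<close> are the next ones for its
    oscillating part, whose contribution vanishes after three integrations by parts.\<close>
  define L0 where "L0 \<rho> = - \<rho> * cos (r * \<rho>) / r\<^sup>2 + 2 * sin (r * \<rho>) / r ^ 3" for \<rho>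
  define L1 where "L1 \<rho> = - \<rho> * sin (r * \<rho>) / r ^ 3 - 3 * cos (r * \<rho>) / r ^ 4" for \<rho>
  define L2 where "L2 \<rho> = \<rho> * cos (r * \<rho>) / r ^ 4 - 4 * sin (r * \<rho>) / r ^ 5" for \<rho>
  define S where "S \<rho> = Si (r * \<rho>) / r ^ 3" for \<rho>
  have dL0: "(L0 has_real_derivative \<rho> * sin (r * \<rho>) / r + cos (r * \<rho>) / r\<^sup>2) (at \<rho>)" for \<rho>
    unfolding L0_def using r
    by (auto intro!: derivative_eq_intros simp: field_simps eval_nat_numeral)
  have dL1: "(L1 has_real_derivative L0 \<rho>) (at \<rho>)" for \<rho>
    unfolding L0_def L1_def using r
    by (auto intro!: derivative_eq_intros simp: field_simps eval_nat_numeral)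
  have dL2: "(L2 has_real_derivative L1 \<rho>) (at \<rho>)" for \<rho>
    unfolding L1_def L2_def using r
    by (auto intro!: derivative_eq_intros simp: field_simps eval_nat_numeral)
  have dS: "(S has_real_derivative sinc (r * \<rho>) / r\<^sup>2) (at \<rho>)" for \<rho>
  proof -
    have "((\<lambda>\<rho>. Si (r * \<rho>)) has_real_derivative sinc (r * \<rho>) * r) (at \<rho>)"
      by (rule DERIV_chain2[OF DERIV_Si]) (auto intro!: derivative_eq_intros)
    then have "(S has_real_derivative sinc (r * \<rho>) * r / r ^ 3) (at \<rho>)"
      unfolding S_def by (rule DERIV_cdivide)
    then show ?thesis
      using r by (simp add: eval_nat_numeral)
  qed
  have dK: "((\<lambda>\<rho>. L0 \<rho> - S \<rho>) has_real_derivative field_kernel r \<rho>) (at \<rho>)" for \<rho>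
    unfolding field_kernel_def diff_divide_distrib add_diff_eq by (rule DERIV_diff[OF dL0 dS])
  have cL: "continuous_on A L0" "continuous_on A L1" "continuous_on A L2" "continuous_on A S" for A
    by (rule continuous_at_imp_continuous_on, rule ballI, rule DERIV_isCont,
        rule dL0 dL1 dL2 dS)+
  have cK: "continuous_on UNIV (field_kernel r)"
    unfolding field_kernel_def using r by (intro continuous_intros) auto
  have c: "continuous_on A (\<lambda>t. \<psi> (\<epsilon> * t))" "continuous_on A (\<lambda>t. \<psi>' (\<epsilon> * t))"
      "continuous_on A (\<lambda>t. \<psi>'' (\<epsilon> * t))" "continuous_on A (\<lambda>t. \<psi>''' (\<epsilon> * t))" for A \<epsilon>
    by (rule continuous_on_compose2[OF continuous(1)] continuous_on_compose2[OF continuous(2)]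
        continuous_on_compose2[OF continuous(3)] continuous_on_compose2[OF cont];
        simp add: continuous_on_mult_left)+
  obtain B1 where B1: "\<And>t. 0 \<le> t \<Longrightarrow> \<bar>\<psi>' t\<bar> \<le> B1"
    using cutoff_bound[OF continuous(2), of R] supp(2) by (metis less_imp_le)
  obtain B3 where B3: "\<And>t. 0 \<le> t \<Longrightarrow> \<bar>\<psi>''' t\<bar> \<le> B3"
    using cutoff_bound[OF cont, of R] supp(4) by (metis less_imp_le)
  have B1_nonneg: "0 \<le> B1" and B3_nonneg: "0 \<le> B3"
    using B1[of 0] B3[of 0] by auto
  \<comment> \<open>\<open>P\<close> is what is left of the oscillating part after three
    integrations by parts; \<open>Q\<close> is the error of replacing \<open>S\<close> by its limit
    pi / (2 r^3).\<close>
  define P where "P \<epsilon> = integral {0..R / \<epsilon>} (\<lambda>\<rho>. \<epsilon> ^ 3 * \<psi>''' (\<epsilon> * \<rho>) * L2 \<rho>)" for \<epsilon>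
  define Q where "Q \<epsilon> = integral {0..R / \<epsilon>} (\<lambda>\<rho>. \<epsilon> * \<psi>' (\<epsilon> * \<rho>) * (S \<rho> - pi / (2 * r ^ 3)))" for \<epsilon>
  \<comment> \<open>Makes \<open>L0 - S\<close> vanish at 0. There the cutoff equals 1, so it cannot
    remove the boundary term itself.\<close>
  have Si0: "Si 0 = 0"
    using Si_neg[of 0] by simp
  have split: "integral {0..R / \<epsilon>} (\<lambda>\<rho>. \<psi> (\<epsilon> * \<rho>) * field_kernel r \<rho>)
    = Q \<epsilon> - P \<epsilon> - pi / (2 * r ^ 3)" if \<epsilon>: "0 < \<epsilon>" for \<epsilon>
  proof -
    have b: "0 \<le> R / \<epsilon>" and e: "\<epsilon> * (R / \<epsilon>) = R"
      using \<epsilon> R by auto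
    have d: "((\<lambda>t. \<psi> (\<epsilon> * t)) has_real_derivative \<epsilon> * \<psi>' (\<epsilon> * t)) (at t)"
        "((\<lambda>t. \<epsilon> * \<psi>' (\<epsilon> * t)) has_real_derivative \<epsilon>\<^sup>2 * \<psi>'' (\<epsilon> * t)) (at t)"
        "((\<lambda>t. \<epsilon>\<^sup>2 * \<psi>'' (\<epsilon> * t)) has_real_derivative \<epsilon> ^ 3 * \<psi>''' (\<epsilon> * t)) (at t)" for t
      using has_real_derivative_dilation[of \<psi> \<psi>', OF deriv(1), of 1 \<epsilon> t]
        has_real_derivative_dilation[of \<psi>' \<psi>'', OF deriv(2), of \<epsilon> \<epsilon> t]
        has_real_derivative_dilation[of \<psi>'' \<psi>''', OF deriv(3), of "\<epsilon>\<^sup>2" \<epsilon> t]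
      by (simp_all add: power2_eq_square power3_eq_cube)
    have z: "\<psi>' 0 = 0" "\<psi>'' 0 = 0" "\<psi> 0 = 1"
      using derivs_near_0[of 0] near_0[of 0] \<delta> by auto
    have "integral {0..R / \<epsilon>} (\<lambda>\<rho>. \<psi> (\<epsilon> * \<rho>) * field_kernel r \<rho>)
      = - integral {0..R / \<epsilon>} (\<lambda>\<rho>. \<epsilon> * \<psi>' (\<epsilon> * \<rho>) * (L0 \<rho> - S \<rho>))"
      by (rule integral_by_parts_vanishing[OF b d(1) dK])
        (use e supp Si0 in \<open>auto simp: L0_def S_def intro!: continuous_intros c cK\<close>)
    also have "\<dots> = - integral {0..R / \<epsilon>} (\<lambda>\<rho>. \<epsilon> * \<psi>' (\<epsilon> * \<rho>) * L0 \<rho>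
        - \<epsilon> * \<psi>' (\<epsilon> * \<rho>) * (S \<rho> - pi / (2 * r ^ 3)) - (pi / (2 * r ^ 3)) * (\<epsilon> * \<psi>' (\<epsilon> * \<rho>)))"
      by (simp add: algebra_simps)
    also have "\<dots> = - (integral {0..R / \<epsilon>} (\<lambda>\<rho>. \<epsilon> * \<psi>' (\<epsilon> * \<rho>) * L0 \<rho>) - Q \<epsilon>
        - integral {0..R / \<epsilon>} (\<lambda>\<rho>. (pi / (2 * r ^ 3)) * (\<epsilon> * \<psi>' (\<epsilon> * \<rho>))))"
    proof -
      have "(\<lambda>\<rho>. \<epsilon> * \<psi>' (\<epsilon> * \<rho>) * L0 \<rho>) integrable_on {0..R / \<epsilon>}"
        "(\<lambda>\<rho>. \<epsilon> * \<psi>' (\<epsilon> * \<rho>) * (S \<rho> - pi / (2 * r ^ 3))) integrable_on {0..R / \<epsilon>}"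
        "(\<lambda>\<rho>. (pi / (2 * r ^ 3)) * (\<epsilon> * \<psi>' (\<epsilon> * \<rho>))) integrable_on {0..R / \<epsilon>}"
        by (intro integrable_continuous_real continuous_on_mult continuous_on_diff
            continuous_on_const c cL)+
      then show ?thesis
        unfolding Q_def
        by (simp only: Henstock_Kurzweil_Integration.integral_diff
            Henstock_Kurzweil_Integration.integrable_diff)
    qed
    \<comment> \<open>The increment of the cutoff from 0 to its end is -1, whatever its shape: this
      produces the limit value.\<close>
    also have "integral {0..R / \<epsilon>} (\<lambda>\<rho>. (pi / (2 * r ^ 3)) * (\<epsilon> * \<psi>' (\<epsilon> * \<rho>))) = - pi / (2 * r ^ 3)"
    proof -
      have "((\<lambda>\<rho>. \<epsilon> * \<psi>' (\<epsilon> * \<rho>)) has_integral (\<psi> (\<epsilon> * (R / \<epsilon>)) - \<psi> (\<epsilon> * 0))) {0..R / \<epsilon>}"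
        using b d(1) by (intro fundamental_theorem_of_calculus)
          (auto simp: has_real_derivative_iff_has_vector_derivative
            intro: has_vector_derivative_at_within)
      then have "((\<lambda>\<rho>. \<epsilon> * \<psi>' (\<epsilon> * \<rho>)) has_integral (- 1)) {0..R / \<epsilon>}"
        unfolding e using supp(1)[of R] z by simp
      from integral_unique[OF has_integral_mult_right[OF this, of "pi / (2 * r ^ 3)"]] show ?thesis
        by (simp only: mult_minus1_right minus_divide_left)
    qed
    \<comment> \<open>\<open>L1\<close> is not zero at 0; the boundary term disappears because the
      cutoff is constant near 0, so \<open>\<psi>' 0 = 0\<close>.\<close>
    also have "integral {0..R / \<epsilon>} (\<lambda>\<rho>. \<epsilon> * \<psi>' (\<epsilon> * \<rho>) * L0 \<rho>)
      = - integral {0..R / \<epsilon>} (\<lambda>\<rho>. \<epsilon>\<^sup>2 * \<psi>'' (\<epsilon> * \<rho>) * L1 \<rho>)"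
      by (rule integral_by_parts_vanishing[OF b d(2) dL1])
        (use e supp z in \<open>auto intro!: continuous_intros c cL\<close>)
    also have "integral {0..R / \<epsilon>} (\<lambda>\<rho>. \<epsilon>\<^sup>2 * \<psi>'' (\<epsilon> * \<rho>) * L1 \<rho>) = - P \<epsilon>"
      unfolding P_def by (rule integral_by_parts_vanishing[OF b d(3) dL2])
        (use e supp z in \<open>auto intro!: continuous_intros c cL\<close>)
    finally show ?thesis
      by simp
  qed
  have P: "(P \<longlongrightarrow> 0) (at_right 0)"
  proof (rule Lim_null_comparison)
    have "\<bar>P \<epsilon>\<bar> \<le> R * B3 * (R * \<epsilon> / r ^ 4 + 4 * \<epsilon>\<^sup>2 / r ^ 5)" if \<epsilon>: "0 < \<epsilon>" for \<epsilon>
    proof -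
      have L2: "\<bar>L2 \<rho>\<bar> \<le> R / \<epsilon> / r ^ 4 + 4 / r ^ 5" if "\<rho> \<in> {0..R / \<epsilon>}" for \<rho>
      proof -
        have "\<bar>\<rho> * cos (r * \<rho>)\<bar> \<le> R / \<epsilon> * 1"
          unfolding abs_mult using that by (intro mult_mono) auto
        from divide_right_mono[OF this, of "r ^ 4"] have "\<bar>\<rho> * cos (r * \<rho>) / r ^ 4\<bar> \<le> R / \<epsilon> / r ^ 4"
          using r by (simp add: abs_divide)
        moreover have "\<bar>4 * sin (r * \<rho>) / r ^ 5\<bar> \<le> 4 / r ^ 5"
          using r by (simp add: abs_divide abs_mult divide_right_mono)
        ultimately show ?thesis
          unfolding L2_def by linarith
      qed
      have "norm (P \<epsilon>) \<le> \<epsilon> ^ 3 * B3 * (R / \<epsilon> / r ^ 4 + 4 / r ^ 5) * (R / \<epsilon> - 0)"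
        unfolding P_def
      proof (rule integral_bound)
        fix \<rho> assume \<rho>: "\<rho> \<in> {0..R / \<epsilon>}"
        have "\<bar>\<epsilon> ^ 3 * \<psi>''' (\<epsilon> * \<rho>)\<bar> \<le> \<epsilon> ^ 3 * B3"
          using \<epsilon> B3[of "\<epsilon> * \<rho>"] \<rho> by (simp add: abs_mult)
        then show "norm (\<epsilon> ^ 3 * \<psi>''' (\<epsilon> * \<rho>) * L2 \<rho>) \<le> \<epsilon> ^ 3 * B3 * (R / \<epsilon> / r ^ 4 + 4 / r ^ 5)"
          unfolding real_norm_def abs_mult[of _ "L2 \<rho>"] using L2[OF \<rho>] \<epsilon> B3_nonneg
          by (intro mult_mono) auto
      qed (use \<epsilon> R in \<open>auto intro!: continuous_intros c cL\<close>)
      also have "\<dots> = R * B3 * (R * \<epsilon> / r ^ 4 + 4 * \<epsilon>\<^sup>2 / r ^ 5)"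
        using \<epsilon> r by (simp add: field_simps eval_nat_numeral)
      finally show ?thesis
        by simp
    qed
    then show "\<forall>\<^sub>F \<epsilon> in at_right 0. norm (P \<epsilon>) \<le> R * B3 * (R * \<epsilon> / r ^ 4 + 4 * \<epsilon>\<^sup>2 / r ^ 5)"
      by (auto intro!: eventually_at_rightI[of 0 1])
    have "((\<lambda>\<epsilon>. R * B3 * (R * \<epsilon> / r ^ 4 + 4 * \<epsilon>\<^sup>2 / r ^ 5))
        \<longlongrightarrow> R * B3 * (R * 0 / r ^ 4 + 4 * 0\<^sup>2 / r ^ 5)) (at_right 0)"
      using r by (intro tendsto_intros) auto
    then show "((\<lambda>\<epsilon>. R * B3 * (R * \<epsilon> / r ^ 4 + 4 * \<epsilon>\<^sup>2 / r ^ 5)) \<longlongrightarrow> 0) (at_right 0)"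
      by simp
  qed
  have Q: "(Q \<longlongrightarrow> 0) (at_right 0)"
  proof (rule tendstoI)
    fix e :: real
    assume e: "0 < e"
    \<comment> \<open>Chosen so that the final estimate R B1 \<open>\<eta>\<close> / r^3 becomes e
      times R B1 / (R B1 + 1), which is less than e; the summand 1 keeps the denominator positive
      when B1 = 0.\<close>
    define \<eta> where "\<eta> = e * r ^ 3 / (R * B1 + 1)"
    have den: "0 < R * B1 + 1"
      using R B1_nonneg by (simp add: add_nonneg_pos)
    then have \<eta>: "0 < \<eta>"
      using e r by (simp add: \<eta>_def)
    have "\<forall>\<^sub>F t in at_top. dist (Si t) (pi / 2) < \<eta>"
      using Si_at_top \<eta> by (rule tendstoD)
    then obtain T0 where T0: "\<And>t. T0 \<le> t \<Longrightarrow> \<bar>Si t - pi / 2\<bar> < \<eta>"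
      unfolding eventually_at_top_linorder dist_real_def by blast
    define T where "T = max T0 1"
    have T: "0 < T" "\<And>t. T \<le> t \<Longrightarrow> \<bar>Si t - pi / 2\<bar> < \<eta>"
      using T0 by (simp_all add: T_def)
    \<comment> \<open>Either \<open>\<epsilon> * \<rho> < \<delta>\<close>, where
      \<open>\<psi>'\<close> vanishes, or \<open>r * \<rho>\<close> is at least
      \<open>r * \<delta> / \<epsilon>\<close>, which exceeds \<open>T\<close>, and there
      \<open>Si\<close> is within \<open>\<eta>\<close> of pi / 2.\<close>
    have "\<bar>Q \<epsilon>\<bar> < e" if \<epsilon>: "0 < \<epsilon>" "\<epsilon> < r * \<delta> / T" for \<epsilon>
    proof -
      have "norm (Q \<epsilon>) \<le> \<epsilon> * B1 * (\<eta> / r ^ 3) * (R / \<epsilon> - 0)"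
        unfolding Q_def
      proof (rule integral_bound)
        fix \<rho> assume \<rho>: "\<rho> \<in> {0..R / \<epsilon>}"
        show "norm (\<epsilon> * \<psi>' (\<epsilon> * \<rho>) * (S \<rho> - pi / (2 * r ^ 3))) \<le> \<epsilon> * B1 * (\<eta> / r ^ 3)"
        proof (cases "\<epsilon> * \<rho> < \<delta>")
          case True
          then have "\<psi>' (\<epsilon> * \<rho>) = 0"
            using \<epsilon> \<rho> by (intro derivs_near_0) auto
          then show ?thesis
            using \<epsilon> B1_nonneg \<eta> r by simp
        next
          case False
          have "T * \<epsilon> < r * \<delta>"
            using \<epsilon> T(1) by (simp add: pos_less_divide_eq mult.commute)
          also have "r * \<delta> \<le> r * (\<epsilon> * \<rho>)"
            using False r by simp
          finally have "T * \<epsilon> < r * \<rho> * \<epsilon>"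
            by (simp only: mult_ac)
          then have "T \<le> r * \<rho>"
            using \<epsilon> by simp
          then have "\<bar>Si (r * \<rho>) - pi / 2\<bar> \<le> \<eta>"
            using T(2) by (simp add: less_imp_le)
          moreover have "S \<rho> - pi / (2 * r ^ 3) = (Si (r * \<rho>) - pi / 2) / r ^ 3"
            by (simp add: S_def diff_divide_distrib)
          ultimately have "\<bar>S \<rho> - pi / (2 * r ^ 3)\<bar> \<le> \<eta> / r ^ 3"
            using r by (simp add: abs_divide divide_right_mono)
          moreover have "\<bar>\<epsilon> * \<psi>' (\<epsilon> * \<rho>)\<bar> \<le> \<epsilon> * B1"
            using \<epsilon> B1[of "\<epsilon> * \<rho>"] \<rho> by (simp add: abs_mult)
          ultimately show ?thesis
            unfolding real_norm_def abs_mult[of _ "S \<rho> - pi / (2 * r ^ 3)"] using \<epsilon> B1_nonneg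
            by (intro mult_mono) auto
        qed
      qed (use \<epsilon> R in \<open>auto intro!: continuous_intros c cL\<close>)
      also have "\<dots> = e * (R * B1 / (R * B1 + 1))"
        using \<epsilon> r den by (simp add: \<eta>_def)
      also have "\<dots> < e * 1"
        using e den by (intro mult_strict_left_mono) (auto simp: divide_less_eq_1)
      finally show ?thesis
        by simp
    qed
    then show "\<forall>\<^sub>F \<epsilon> in at_right 0. dist (Q \<epsilon>) 0 < e"
      using r \<delta> T(1) by (auto intro!: eventually_at_rightI[of 0 "r * \<delta> / T"])
  qed
  have "((\<lambda>\<epsilon>. Q \<epsilon> - P \<epsilon> - pi / (2 * r ^ 3)) \<longlongrightarrow> - pi / (2 * r ^ 3)) (at_right 0)"
    using tendsto_diff[OF tendsto_diff[OF Q P] tendsto_const[of "pi / (2 * r ^ 3)"]] by simp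
  then show ?thesis
  proof (rule Lim_transform_eventually)
    show "\<forall>\<^sub>F \<epsilon> in at_right 0. Q \<epsilon> - P \<epsilon> - pi / (2 * r ^ 3)
      = integral {0..R / \<epsilon>} (\<lambda>\<rho>. \<psi> (\<epsilon> * \<rho>) * field_kernel r \<rho>)"
      by (rule eventually_at_rightI[of 0 1]) (simp_all add: split)
  qed
qed

end

section \<open>The limit of \<open>F_eps\<close> for a smooth cutoff\<close>

lemma cutoff_square_exists:
  assumes smooth: "smooth \<phi>" and supp: "compact (closure {t. \<phi> t \<noteq> 0})"
    and one: "eventually (\<lambda>t. \<phi> t = 1) (nhds 0)"
  shows "\<exists>\<psi>' \<psi>'' \<psi>''' \<delta> R. cutoff (\<lambda>t. (\<phi> t)\<^sup>2) \<psi>' \<psi>'' \<psi>''' \<delta> R"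
proof -
  define f where "f n = (deriv ^^ n) \<phi>" for n
  have f0: "f 0 = \<phi>"
    by (simp add: f_def)
  have df: "(f n has_real_derivative f (Suc n) t) (at t)" for n t
    using smooth unfolding smooth_def f_def
    by (simp add: DERIV_deriv_iff_field_differentiable)
  have cf: "continuous_on UNIV (f n)" for n
    using DERIV_isCont[OF df] by (simp add: continuous_at_imp_continuous_on)
  have "bounded {t. \<phi> t \<noteq> 0}"
    using supp by (meson bounded_closure_image bounded_subset closure_subset compact_imp_bounded)
  then obtain b where b: "\<And>t. \<phi> t \<noteq> 0 \<Longrightarrow> \<bar>t\<bar> \<le> b"
    unfolding bounded_iff by auto
  \<comment> \<open>The summand 1 makes \<open>R\<close> positive and puts it strictly beyond |b|,
    inside an open half-line on which the function, hence also its derivative, vanishes.\<close>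
  define R where "R = \<bar>b\<bar> + 1"
  have z0: "f 0 t = 0" if "\<bar>b\<bar> < t" for t
    using b[of t] that unfolding f0 by fastforce
  have z1: "f 1 t = 0" if "\<bar>b\<bar> < t" for t
  proof -
    have "((\<lambda>_. 0) has_real_derivative f 1 t) (at t)"
      using has_field_derivative_transform_within_open[OF df[of 0 t], of "{\<bar>b\<bar><..}" "\<lambda>_. 0"]
        that z0 by simp
    then show ?thesis
      using DERIV_const DERIV_unique by blast
  qed
  obtain \<delta> where \<delta>: "0 < \<delta>" "\<And>t. \<bar>t\<bar> < \<delta> \<Longrightarrow> \<phi> t = 1"
    using one unfolding eventually_nhds_metric by (auto simp: dist_real_def)
  \<comment> \<open>By the Leibniz rule every term of the first three derivatives of the square
    contains \<open>f 0\<close> or \<open>f 1\<close>, so \<open>z0\<close> and \<open>z1\<close>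
    settle the support of all of them.\<close>
  have "cutoff (\<lambda>t. (\<phi> t)\<^sup>2) (\<lambda>t. 2 * f 0 t * f 1 t) (\<lambda>t. 2 * ((f 1 t)\<^sup>2 + f 0 t * f 2 t))
    (\<lambda>t. 2 * (3 * f 1 t * f 2 t + f 0 t * f 3 t)) \<delta> R"
  proof
    have d: "(f 0 has_real_derivative f 1 t) (at t)" "(f 1 has_real_derivative f 2 t) (at t)"
      "(f 2 has_real_derivative f 3 t) (at t)" for t
      using df[of 0 t] df[of 1 t] df[of 2 t] by (simp_all add: eval_nat_numeral)
    fix t
    show "((\<lambda>t. (\<phi> t)\<^sup>2) has_real_derivative 2 * f 0 t * f 1 t) (at t)"
      unfolding f0[symmetric] by (rule derivative_eq_intros d refl)+ simp
    show "((\<lambda>t. 2 * f 0 t * f 1 t) has_real_derivative 2 * ((f 1 t)\<^sup>2 + f 0 t * f 2 t)) (at t)"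
      by (rule derivative_eq_intros d refl)+ (simp add: power2_eq_square algebra_simps)
    show "((\<lambda>t. 2 * ((f 1 t)\<^sup>2 + f 0 t * f 2 t)) has_real_derivative
        2 * (3 * f 1 t * f 2 t + f 0 t * f 3 t)) (at t)"
      by (rule derivative_eq_intros d refl)+ (simp add: algebra_simps)
    show "continuous_on UNIV (\<lambda>t. 2 * (3 * f 1 t * f 2 t + f 0 t * f 3 t))"
      by (intro continuous_intros cf)
    show "\<bar>t\<bar> < \<delta> \<Longrightarrow> (\<phi> t)\<^sup>2 = 1"
      by (simp add: \<delta>)
    show "R \<le> t \<Longrightarrow> (\<phi> t)\<^sup>2 = 0" "R \<le> t \<Longrightarrow> 2 * f 0 t * f 1 t = 0"
      "R \<le> t \<Longrightarrow> 2 * ((f 1 t)\<^sup>2 + f 0 t * f 2 t) = 0"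
      "R \<le> t \<Longrightarrow> 2 * (3 * f 1 t * f 2 t + f 0 t * f 3 t) = 0"
      using z0[of t] z1[of t] by (simp_all add: R_def f0)
  qed (use \<delta> in \<open>simp_all add: R_def\<close>)
  then show ?thesis
    by blast
qed

lemma smooth_imp_continuous:
  assumes "smooth \<phi>"
  shows "continuous_on UNIV \<phi>"
proof -
  have "\<phi> field_differentiable at t" for t
    using assms unfolding smooth_def by (metis funpow_0)
  then show ?thesis
    by (simp add: continuous_at_imp_continuous_on field_differentiable_imp_continuous_at)
qed

lemma F_eps_lborel:
  assumes "continuous_on UNIV \<phi>"
  shows "F_eps \<phi> \<epsilon> x = 1 / (2 * pi) ^ 3 *
    (LINT k|lborel. (\<phi> (\<epsilon> * norm k))\<^sup>2 * cos (k \<bullet> x) * (((k $ 1)\<^sup>2 + (k $ 2)\<^sup>2) / (norm k)\<^sup>2))"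
proof -
  have [measurable]: "\<phi> \<in> borel_measurable borel"
    using assms by (rule borel_measurable_continuous_onI)
  show ?thesis
    unfolding F_eps_def by (subst integral_completion) simp_all
qed

lemma F_eps_limit:
  assumes smooth: "smooth \<phi>" and supp: "compact (closure {t. \<phi> t \<noteq> 0})"
    and one: "eventually (\<lambda>t. \<phi> t = 1) (nhds 0)"
    and x: "x $ 3 = 0" "x \<noteq> 0"
  shows "((\<lambda>\<epsilon>. F_eps \<phi> \<epsilon> x) \<longlongrightarrow> - 1 / (4 * pi * norm x ^ 3)) (at_right 0)"
proof -
  obtain \<psi>' \<psi>'' \<psi>''' \<delta> R where "cutoff (\<lambda>t. (\<phi> t)\<^sup>2) \<psi>' \<psi>'' \<psi>''' \<delta> R"
    using cutoff_square_exists[OF smooth supp one] by blast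
  then interpret cutoff "\<lambda>t. (\<phi> t)\<^sup>2" \<psi>' \<psi>'' \<psi>''' \<delta> R .
  have cont: "continuous_on UNIV \<phi>"
    using smooth by (rule smooth_imp_continuous)
  have eq: "F_eps \<phi> \<epsilon> x = 1 / (2 * pi) ^ 3 * (4 * pi *
      integral {0..R / \<epsilon>} (\<lambda>\<rho>. (\<phi> (\<epsilon> * \<rho>))\<^sup>2 * field_kernel (norm x) \<rho>))" if \<epsilon>: "0 < \<epsilon>" for \<epsilon>
  proof -
    have c: "continuous_on UNIV (\<lambda>t. (\<phi> (\<epsilon> * t))\<^sup>2)"
      by (intro continuous_on_power continuous_on_compose2[OF cont] continuous_on_mult_left
          continuous_on_id) simp
    have s: "(\<phi> (\<epsilon> * t))\<^sup>2 = 0" if "R / \<epsilon> < t" for t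
      using supp(1)[of "\<epsilon> * t"] that \<epsilon> by (simp add: pos_divide_less_eq mult.commute)
    show ?thesis
      unfolding F_eps_lborel[OF cont] by (subst integral_planar[OF x _ c s]) (use \<epsilon> R in simp_all)
  qed
  have "((\<lambda>\<epsilon>. 1 / (2 * pi) ^ 3 * (4 * pi *
      integral {0..R / \<epsilon>} (\<lambda>\<rho>. (\<phi> (\<epsilon> * \<rho>))\<^sup>2 * field_kernel (norm x) \<rho>)))
    \<longlongrightarrow> 1 / (2 * pi) ^ 3 * (4 * pi * (- pi / (2 * norm x ^ 3)))) (at_right 0)"
    by (intro tendsto_mult_left kernel_limit) (use x in simp)
  moreover have "1 / (2 * pi) ^ 3 * (4 * pi * (- pi / (2 * norm x ^ 3))) = - 1 / (4 * pi * norm x ^ 3)"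
    using x by (simp add: field_simps power3_eq_cube)
  ultimately have "((\<lambda>\<epsilon>. 1 / (2 * pi) ^ 3 * (4 * pi *
      integral {0..R / \<epsilon>} (\<lambda>\<rho>. (\<phi> (\<epsilon> * \<rho>))\<^sup>2 * field_kernel (norm x) \<rho>)))
    \<longlongrightarrow> - 1 / (4 * pi * norm x ^ 3)) (at_right 0)"
    by simp
  then show ?thesis
  proof (rule Lim_transform_eventually)
    show "\<forall>\<^sub>F \<epsilon> in at_right 0. 1 / (2 * pi) ^ 3 * (4 * pi *
        integral {0..R / \<epsilon>} (\<lambda>\<rho>. (\<phi> (\<epsilon> * \<rho>))\<^sup>2 * field_kernel (norm x) \<rho>)) = F_eps \<phi> \<epsilon> x"
      by (rule eventually_at_rightI[of 0 1]) (simp_all add: eq)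
  qed
qed

section \<open>Spin expectations\<close>

text \<open>Expanding a product of sums gives a sum over choice functions, and these are exactly the
  labels \<open>'n \<Rightarrow> 2\<close> of the product basis.\<close>

lemma herm_tensor: "herm (tensor v) (tensor w) = (\<Prod>j\<in>UNIV. herm (v j) (w j))"
proof -
  have "(\<Prod>j\<in>UNIV. herm (v j) (w j))
    = (\<Sum>s\<in>PiE UNIV (\<lambda>_. UNIV). \<Prod>j\<in>UNIV. v j $ s j * cnj (w j $ s j))"
    unfolding herm_def by (rule prod_sum_PiE) auto
  then show ?thesis
    by (simp add: herm_def tensor_def prod.distrib)
qed

text \<open>In row \<open>s\<close> only the labels that agree with \<open>s\<close> off
  \<open>l\<close> contribute. They are parametrised by their value at \<open>l\<close>, and the
  other factors of the product come out of the sum.\<close>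

lemma site_op_tensor:
  fixes l :: "'n::finite"
  shows "site_op l A *v tensor v = tensor (v(l := A *v v l))"
proof (rule vec_eq_iff[THEN iffD2], rule allI)
  fix s :: "'n \<Rightarrow> 2"
  let ?upd = "\<lambda>c. s(l := c)"
  have inj: "inj ?upd"
    by (auto simp: inj_def fun_eq_iff dest!: spec[of _ l])
  have range: "{t. \<forall>j. j \<noteq> l \<longrightarrow> s j = t j} = range ?upd"
  proof (intro set_eqI iffI)
    fix t assume "t \<in> {t. \<forall>j. j \<noteq> l \<longrightarrow> s j = t j}"
    then have "t = ?upd (t l)"
      by (auto simp: fun_eq_iff)
    then show "t \<in> range ?upd"
      by blast
  qed auto
  have "(site_op l A *v tensor v) $ s
    = (\<Sum>t\<in>{t. \<forall>j. j \<noteq> l \<longrightarrow> s j = t j}. A $ s l $ t l * (\<Prod>j\<in>UNIV. v j $ t j))"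
    by (auto simp: matrix_vector_mult_def site_op_def tensor_def split: if_splits
        intro!: sum.mono_neutral_cong_right)
  also have "\<dots> = (\<Sum>c\<in>UNIV. A $ s l $ c * (\<Prod>j\<in>UNIV. v j $ ?upd c j))"
    unfolding range by (subst sum.reindex[OF inj]) simp
  also have "\<dots> = (\<Sum>c\<in>UNIV. A $ s l $ c * v l $ c) * (\<Prod>j\<in>UNIV - {l}. v j $ s j)"
    by (simp add: prod.remove[of UNIV l] sum_distrib_right mult.assoc)
  also have "\<dots> = tensor (v(l := A *v v l)) $ s"
    by (simp add: tensor_def prod.remove[of UNIV l] matrix_vector_mult_def)
  finally show "(site_op l A *v tensor v) $ s = tensor (v(l := A *v v l)) $ s" .
qed

lemma herm_site_op_tensor:
  assumes "\<And>j. herm (v j) (v j) = 1"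
  shows "herm (site_op l A *v tensor v) (tensor v) = herm (A *v v l) (v l)"
  unfolding site_op_tensor herm_tensor using assms by (simp add: prod.remove[of UNIV l])

lemma herm_self: "herm v v = complex_of_real ((norm v)\<^sup>2)"
  unfolding herm_def complex_norm_square[symmetric]
  by (simp add: norm_vec_def L2_set_def sum_nonneg)

lemma herm_2: "herm (v :: complex^2) w = v $ 1 * cnj (w $ 1) + v $ 2 * cnj (w $ 2)"
  by (simp add: herm_def sum_2)

text \<open>A unit eigenvector of \<open>pauli 3\<close> is determined only up to a phase, so it is
  described by its vanishing coordinate.\<close>

lemma herm_pauli_up:
  assumes "norm (v :: complex^2) = 1" "v $ 2 = 0"
  shows "herm (pauli m *v v) v = (if m = 3 then 1 else 0)"
  using assms herm_self[of v] exhaust_3[of m]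
  by (auto simp: herm_2 pauli_def matrix_vector_mult_def sum_2)

lemma herm_pauli_down:
  assumes "norm (v :: complex^2) = 1" "v $ 1 = 0"
  shows "herm (pauli m *v v) v = (if m = 3 then - 1 else 0)"
  using assms herm_self[of v] exhaust_3[of m]
  by (auto simp: herm_2 pauli_def matrix_vector_mult_def sum_2)

text \<open>Flipping the label at \<open>l\<close> is an involution of the basis that exchanges the
  two diagonal entries of \<open>A\<close>, so the trace equals its own negative.\<close>

lemma trace_site_op:
  fixes l :: "'n::finite"
  assumes "A $ 1 $ 1 + A $ 2 $ 2 = 0"
  shows "trace (site_op l A) = 0"
proof -
  define flip where "flip s = s(l := if s l = 1 then 2 else (1::2))" for s :: "'n \<Rightarrow> 2"
  have "flip (flip s) = s" for s
    using exhaust_2[of "s l"] by (auto simp: flip_def fun_eq_iff)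
  then have "bij flip"
    by (intro o_bij[of flip]) (auto simp: fun_eq_iff)
  then have "(\<Sum>s\<in>UNIV. A $ flip s l $ flip s l) = (\<Sum>s\<in>UNIV. A $ s l $ s l)"
    by (rule sum.reindex_bij_betw)
  moreover have "A $ s l $ s l + A $ flip s l $ flip s l = 0" for s
    using exhaust_2[of "s l"] assms by (auto simp: flip_def add.commute)
  then have "(\<Sum>s\<in>UNIV. A $ s l $ s l) + (\<Sum>s\<in>UNIV. A $ flip s l $ flip s l) = 0"
    by (simp flip: sum.distrib)
  ultimately show ?thesis
    by (simp add: trace_def site_op_def)
qed

text \<open>Needed to evaluate \<open>pi_fun\<close> at \<open>i_sigma m l\<close>, since
  \<open>pi_fun\<close> is unspecified outside \<open>su_alg\<close>.\<close>

lemma i_sigma_in_su_alg: "i_sigma m l \<in> su_alg"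
proof -
  have "pauli m $ 1 $ 1 + pauli m $ 2 $ 2 = 0"
    by (simp add: pauli_def)
  then have "trace (sigma m l) = 0"
    unfolding sigma_def by (rule trace_site_op)
  then have "trace (i_sigma m l) = 0"
    by (simp add: i_sigma_def trace_def map_matrix_def sum_distrib_left[symmetric])
  moreover have pauli: "cnj (pauli m $ a $ b) = pauli m $ b $ a" for a b
    using exhaust_2[of a] exhaust_2[of b] by (auto simp: pauli_def)
  have "cnj (sigma m l $ s $ t) = sigma m l $ t $ s" for s t
    by (auto simp: sigma_def site_op_def pauli)
  then have "map_matrix cnj (transpose (i_sigma m l)) = - i_sigma m l"
    by (simp add: i_sigma_def vec_eq_iff map_matrix_def transpose_def)
  ultimately show ?thesis
    by (simp add: su_alg_def)
qed

lemma i_sigma_mult_vec: "i_sigma m l *v u = \<i> *s (sigma m l *v u)"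
  by (simp add: vec_eq_iff i_sigma_def map_matrix_def matrix_vector_mult_def sum_distrib_left mult.assoc)

lemma pi_fun_i_sigma: "pi_fun u (i_sigma m l) = Re (herm (sigma m l *v u) u)"
proof -
  have "herm (\<i> *s (sigma m l *v u)) u = \<i> * herm (sigma m l *v u) u"
    by (simp add: herm_def sum_distrib_left mult.assoc)
  then show ?thesis
    by (simp add: pi_fun_def i_sigma_in_su_alg i_sigma_mult_vec)
qed

text \<open>Since \<open>\<beta>\<close> points along e_3, the hypotheses on \<open>b0\<close> and
  \<open>b1\<close> are eigenvalue equations for \<open>pauli 3\<close>. They force the first
  coordinate of \<open>b0\<close> and the second of \<open>b1\<close> to equal their
  negatives.\<close>

lemma herm_sigma_a_vec:
  fixes b0 b1 :: "complex^2"
  assumes beta: "\<beta> = vector [0, 0, norm \<beta>]" "\<beta> \<noteq> 0"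
    and b0: "norm b0 = 1"
      "(\<Sum>m\<in>UNIV. complex_of_real (\<beta> $ m) *s (pauli m *v b0)) = - (complex_of_real (norm \<beta>) *s b0)"
    and b1: "norm b1 = 1"
      "(\<Sum>m\<in>UNIV. complex_of_real (\<beta> $ m) *s (pauli m *v b1)) = complex_of_real (norm \<beta>) *s b1"
  shows "herm (sigma m l *v a_vec b0 b1 E) (a_vec b0 b1 E)
    = (if m = 3 then complex_of_real (eps_sign E l) else 0)"
proof -
  have \<beta>: "\<beta> $ 1 = 0" "\<beta> $ 2 = 0" "\<beta> $ 3 = norm \<beta>"
    by (subst beta(1), simp)+
  have sum: "(\<Sum>m\<in>UNIV. complex_of_real (\<beta> $ m) *s (pauli m *v b))
    = complex_of_real (norm \<beta>) *s (pauli 3 *v b)" for b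
    by (simp add: sum_3 \<beta>)
  have "complex_of_real (norm \<beta>) * b0 $ 1 = - (complex_of_real (norm \<beta>) * b0 $ 1)"
    using arg_cong[OF b0(2), of "\<lambda>v. v $ 1"] unfolding sum
    by (simp add: pauli_def matrix_vector_mult_def sum_2)
  then have "b0 $ 1 = 0"
    using beta(2) by simp
  moreover have "- (complex_of_real (norm \<beta>) * b1 $ 2) = complex_of_real (norm \<beta>) * b1 $ 2"
    using arg_cong[OF b1(2), of "\<lambda>v. v $ 2"] unfolding sum
    by (simp add: pauli_def matrix_vector_mult_def sum_2)
  then have "b1 $ 2 = 0"
    using beta(2) by simp
  ultimately show ?thesis
    unfolding a_vec_def sigma_def using b0(1) b1(1)
    by (subst herm_site_op_tensor)
      (auto simp: herm_self eps_sign_def herm_pauli_up herm_pauli_down)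
qed

section \<open>Energy of the fixed point\<close>

text \<open>The cutoff does not vanish near 0, so the squared field of the fixed point is controlled
  there only by a multiple of 1 / |k|. The density 2 pi \<open>\<rho>\<close> cancels this
  singularity.\<close>

lemma integrable_inverse_norm:
  "integrable lborel (\<lambda>k::real^3. indicator {..R} (norm k) / norm k)"
proof -
  define g where "g p = indicator {..R} (snd p) / snd p" for p :: "real \<times> real"
  have "g \<in> borel_measurable (borel \<Otimes>\<^sub>M borel)"
    unfolding g_def by measurable
  then have g: "g \<in> borel_measurable borel"
    by (simp add: borel_prod)
  note W = borel_measurable_cone_weight
  have "integrable lborel (\<lambda>p. 2 * pi * snd p * indicator {p. \<bar>fst p\<bar> \<le> snd p} p * g p)"
  proof (rule integrable_lborel_bounded_support[where C = "2 * pi" and R = "2 * R"])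
    show "(\<lambda>p. 2 * pi * snd p * indicator {p. \<bar>fst p\<bar> \<le> snd p} p * g p) \<in> borel_measurable borel"
      using W g by (rule borel_measurable_times)
    fix p :: "real \<times> real"
    show "\<bar>2 * pi * snd p * indicator {p. \<bar>fst p\<bar> \<le> snd p} p * g p\<bar> \<le> 2 * pi"
      by (auto simp: g_def abs_mult split: split_indicator)
    assume "2 * R < norm p"
    moreover have "norm p \<le> \<bar>fst p\<bar> + \<bar>snd p\<bar>"
      using norm_Pair_le[of "fst p" "snd p"] by simp
    ultimately have "\<not> \<bar>fst p\<bar> \<le> snd p \<or> R < snd p"
      by linarith
    then show "2 * pi * snd p * indicator {p. \<bar>fst p\<bar> \<le> snd p} p * g p = 0"
      by (auto simp: g_def)
  qed
  then show ?thesis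
    using integrable_component_norm[OF g] by (simp add: g_def)
qed

text \<open>\<open>SOME\<close> is informative only once a solution is exhibited: G / |k| is one,
  and any other agrees with it off the null set \<open>{0}\<close>.\<close>

lemma some_field_solution:
  assumes meas: "\<And>j. (\<lambda>k. G k $ j) \<in> borel_measurable borel"
    and int: "\<And>j. integrable lborel (\<lambda>k. (G k $ j / norm k)\<^sup>2)"
    and orth: "\<And>k. k \<bullet> G k = 0"
  defines "q \<equiv> SOME q. q \<in> field_space \<and> (AE k in lebesgue. mult_M q k = G k)"
  shows "q \<in> field_space" "AE k in lebesgue. q k = G k /\<^sub>R norm k"
proof -
  have nz: "AE k in lebesgue. k \<noteq> (0 :: real^3)"
    using AE_lborel_singleton[of "0 :: real^3"] by (rule AE_completion)
  have [measurable]: "(\<lambda>k. G k $ j) \<in> borel_measurable borel" for j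
    by (rule meas)
  have comp: "(G k /\<^sub>R norm k) $ j = G k $ j / norm k" for k j
    by (simp add: inverse_eq_divide)
  have m: "(\<lambda>k. (G k /\<^sub>R norm k) $ j) \<in> borel_measurable borel" for j
    by simp
  have "integrable lborel (\<lambda>k. ((G k /\<^sub>R norm k) $ j)\<^sup>2)" for j
    unfolding comp by (rule int)
  then have "integrable lebesgue (\<lambda>k. ((G k /\<^sub>R norm k) $ j)\<^sup>2)" for j
    unfolding comp by (subst integrable_completion) simp_all
  moreover have "(\<lambda>k. (G k /\<^sub>R norm k) $ j) \<in> borel_measurable lebesgue" for j
    using m[of j] by (intro measurable_completion) simp
  ultimately have "(\<lambda>k. G k /\<^sub>R norm k) \<in> field_space"
    by (simp add: field_space_def orth del: vector_scaleR_component)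
  moreover have "AE k in lebesgue. mult_M (\<lambda>k. G k /\<^sub>R norm k) k = G k"
    using nz by eventually_elim (simp add: mult_M_def)
  ultimately have "\<exists>q. q \<in> field_space \<and> (AE k in lebesgue. mult_M q k = G k)"
    by blast
  from someI_ex[OF this] have q: "q \<in> field_space" "AE k in lebesgue. mult_M q k = G k"
    unfolding q_def by blast+
  show "q \<in> field_space"
    by fact
  show "AE k in lebesgue. q k = G k /\<^sub>R norm k"
    using q(2) nz
  proof eventually_elim
    fix k
    assume "mult_M q k = G k" "k \<noteq> 0"
    from \<open>mult_M q k = G k\<close> have "G k = norm k *\<^sub>R q k"
      by (simp add: mult_M_def)
    with \<open>k \<noteq> 0\<close> show "q k = G k /\<^sub>R norm k"
      by simp
  qed
qed

section \<open>Plane waves of the third field component\<close>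

lemma cross3_axis3: "cross3 k (axis 3 1) = vector [k $ 2, - k $ 1, 0]"
  by (simp add: cross3_def axis_def vec_eq_iff forall_3)

text \<open>Common form of \<open>field_a\<close> and \<open>field_b\<close>, to treat sine and
  cosine at once. Only the index 3 is needed because the spin expectations point along e_3.\<close>

definition field_wave :: "(real \<Rightarrow> real) \<Rightarrow> (real \<Rightarrow> real) \<Rightarrow> real^3 \<Rightarrow> real^3 \<Rightarrow> real^3" where
  "field_wave tr chi x k =
     (chi (norm k) * norm k powr (1/2) / (2 * pi) powr (3/2) * tr (k \<bullet> x))
       *\<^sub>R (cross3 k (axis 3 1) /\<^sub>R norm k)"

lemma field_wave_sin: "field_wave sin chi = field_a chi 3"
  and field_wave_cos: "field_wave cos chi = field_b chi 3"
  by (simp_all add: fun_eq_iff field_wave_def field_a_def field_b_def)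

text \<open>The integrand of \<open>F_eps\<close> without its cosine, for the cutoff
  \<open>chi\<close>.\<close>

definition mode_density :: "(real \<Rightarrow> real) \<Rightarrow> real^3 \<Rightarrow> real" where
  "mode_density chi k = (chi (norm k))\<^sup>2 / (2 * pi) ^ 3 * (((k $ 1)\<^sup>2 + (k $ 2)\<^sup>2) / (norm k)\<^sup>2)"

lemma inner_field_wave:
  "field_wave tr chi x k \<bullet> field_wave tr chi y k = norm k * (mode_density chi k * tr (k \<bullet> x) * tr (k \<bullet> y))"
proof -
  have pi: "(2 * pi) powr (3/2) * (2 * pi) powr (3/2) = (2 * pi) ^ 3"
    unfolding powr_add[symmetric] by simp
  have k: "norm k powr (1/2) * norm k powr (1/2) = norm k"
    by (simp add: powr_half_sqrt)
  have E: "cross3 k (axis 3 1) \<bullet> cross3 k (axis 3 1) = (k $ 1)\<^sup>2 + (k $ 2)\<^sup>2"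
    unfolding cross3_axis3 by (simp add: inner_vec_def sum_3 power2_eq_square)
  have "field_wave tr chi x k \<bullet> field_wave tr chi y k
    = (chi (norm k))\<^sup>2 * (norm k powr (1/2) * norm k powr (1/2))
      / ((2 * pi) powr (3/2) * (2 * pi) powr (3/2)) * tr (k \<bullet> x) * tr (k \<bullet> y)
      * ((cross3 k (axis 3 1) \<bullet> cross3 k (axis 3 1)) / (norm k)\<^sup>2)"
    unfolding field_wave_def inner_scaleR_left inner_scaleR_right
    by (simp add: inverse_eq_divide power2_eq_square) (simp only: mult_ac)
  then show ?thesis
    unfolding pi k E mode_density_def by simp
qed

lemma orthogonal_field_wave: "k \<bullet> field_wave tr chi x k = 0"
  by (simp add: field_wave_def dot_cross_self)

lemma norm_field_wave_le:
  assumes "\<bar>chi (norm k)\<bar> \<le> B" "\<bar>tr (k \<bullet> x)\<bar> \<le> 1"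
  shows "norm (field_wave tr chi x k) \<le> B * sqrt (norm k)"
proof -
  have "(norm (cross3 k (axis 3 1)))\<^sup>2 \<le> (norm k)\<^sup>2"
    by (simp add: norm_vec3_sq cross3_axis3)
  then have "norm (cross3 k (axis 3 1)) \<le> norm k"
    by (rule power2_le_imp_le) simp
  then have E: "norm (cross3 k (axis 3 1) /\<^sub>R norm k) \<le> 1"
    by (cases "k = 0") (simp_all add: field_simps)
  have pi: "1 \<le> (2 * pi) powr (3/2)"
    using pi_gt3 by (intro ge_one_powr_ge_zero) auto
  define c where "c = chi (norm k) * norm k powr (1/2) / (2 * pi) powr (3/2)"
  have B: "0 \<le> B * sqrt (norm k)"
    using assms(1) by (intro mult_nonneg_nonneg) auto
  have "\<bar>c\<bar> \<le> B * sqrt (norm k) / 1"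
    unfolding c_def abs_divide abs_mult using assms pi
    by (intro frac_le mult_mono) (auto simp: powr_half_sqrt)
  then have c: "\<bar>c\<bar> \<le> B * sqrt (norm k)"
    by simp
  have "\<bar>c * tr (k \<bullet> x)\<bar> \<le> B * sqrt (norm k) * 1"
    unfolding abs_mult by (rule mult_mono[OF c assms(2) B]) simp
  then have "\<bar>c * tr (k \<bullet> x)\<bar> * norm (cross3 k (axis 3 1) /\<^sub>R norm k) \<le> B * sqrt (norm k) * 1 * 1"
    by (rule mult_mono[OF _ E]) (use B in simp_all)
  then show ?thesis
    unfolding field_wave_def c_def[symmetric] norm_scaleR[of "c * _"] by simp
qed

lemma borel_measurable_field_wave [measurable]:
  assumes [measurable]: "chi \<in> borel_measurable borel" "tr \<in> borel_measurable borel"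
  shows "(\<lambda>k. field_wave tr chi x k $ j) \<in> borel_measurable borel"
proof -
  have "(\<lambda>k. cross3 k (axis 3 1) $ j) \<in> borel_measurable borel"
    using exhaust_3[of j] by (auto simp: cross3_axis3)
  then show ?thesis
    unfolding field_wave_def by simp
qed

text \<open>The divisor |k|^2 serves the square integrability of the solution (membership in
  \<open>field_space\<close>), the divisor |k| the scalar products and the energy. Each wave is
  bounded by a multiple of the square root of |k|.\<close>

lemma integrable_field_wave_product:
  assumes cont: "continuous_on UNIV chi" and supp: "\<And>t. R < t \<Longrightarrow> chi t = 0"
    and tr: "tr \<in> borel_measurable borel" "\<And>t. \<bar>tr t\<bar> \<le> 1"
  shows "integrable lborel (\<lambda>k. field_wave tr chi x k $ j * field_wave tr chi y k $ j / (norm k)\<^sup>2)" (is ?th1)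
    and "integrable lborel (\<lambda>k. field_wave tr chi x k $ j * field_wave tr chi y k $ j / norm k)" (is ?th2)
proof -
  have [measurable]: "chi \<in> borel_measurable borel" "tr \<in> borel_measurable borel"
    using cont tr by (auto intro: borel_measurable_continuous_onI)
  obtain B where B: "\<And>t. 0 \<le> t \<Longrightarrow> \<bar>chi t\<bar> \<le> B"
    using cutoff_bound[OF cont supp] by blast
  have bound: "\<bar>field_wave tr chi x k $ j * field_wave tr chi y k $ j\<bar> \<le> B\<^sup>2 * norm k" for k
  proof -
    have "\<bar>field_wave tr chi z k $ j\<bar> \<le> B * sqrt (norm k)" for z
      using component_le_norm_cart[of "field_wave tr chi z k" j]
          norm_field_wave_le[where x = z and k = k and chi = chi and tr = tr, OF B[OF norm_ge_zero] tr(2)]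
      by simp
    then have "\<bar>field_wave tr chi x k $ j * field_wave tr chi y k $ j\<bar>
      \<le> (B * sqrt (norm k)) * (B * sqrt (norm k))"
      unfolding abs_mult by (intro mult_mono) (use B[of 0] in auto)
    then show ?thesis
      by (simp add: power2_eq_square mult_ac)
  qed
  have zero: "field_wave tr chi z k = 0" if "R < norm k" for z k
    using supp[OF that] by (simp add: field_wave_def)
  show ?th1
  proof (rule Bochner_Integration.integrable_bound)
    show "integrable lborel (\<lambda>k::real^3. B\<^sup>2 * (indicator {..R} (norm k) / norm k))"
      by (intro integrable_mult_right integrable_inverse_norm)
    show "AE k in lborel. norm (field_wave tr chi x k $ j * field_wave tr chi y k $ j / (norm k)\<^sup>2)
      \<le> norm (B\<^sup>2 * (indicator {..R} (norm k) / norm k))"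
    proof (rule AE_I2)
      fix k :: "real^3"
      show "norm (field_wave tr chi x k $ j * field_wave tr chi y k $ j / (norm k)\<^sup>2)
        \<le> norm (B\<^sup>2 * (indicator {..R} (norm k) / norm k))"
      proof (cases "R < norm k")
        case False
        have "\<bar>field_wave tr chi x k $ j * field_wave tr chi y k $ j\<bar> / (norm k)\<^sup>2
          \<le> B\<^sup>2 * norm k / (norm k)\<^sup>2"
          by (intro divide_right_mono bound) simp
        also have "\<dots> = B\<^sup>2 * (indicator {..R} (norm k) / norm k)"
          using False by (simp add: power2_eq_square)
        finally show ?thesis
          by (simp add: abs_divide)
      qed (simp add: zero)
    qed
  qed simp
  show ?th2
  proof (rule integrable_lborel_bounded_support[where C = "B\<^sup>2" and R = R])
    fix k :: "real^3"
    have "\<bar>field_wave tr chi x k $ j * field_wave tr chi y k $ j\<bar> / norm k \<le> B\<^sup>2 * norm k / norm k"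
      by (intro divide_right_mono bound) simp
    also have "\<dots> \<le> B\<^sup>2"
      by simp
    finally show "\<bar>field_wave tr chi x k $ j * field_wave tr chi y k $ j / norm k\<bar> \<le> B\<^sup>2"
      by (simp add: abs_divide)
  qed (simp_all add: zero)
qed

lemma sum_field_wave_product:
  "(\<Sum>j\<in>UNIV. field_wave tr chi x k $ j * field_wave tr chi y k $ j / norm k)
    = mode_density chi k * tr (k \<bullet> x) * tr (k \<bullet> y)"
proof -
  have "(\<Sum>j\<in>UNIV. field_wave tr chi x k $ j * field_wave tr chi y k $ j / norm k)
    = (field_wave tr chi x k \<bullet> field_wave tr chi y k) / norm k"
    by (simp add: inner_vec_def sum_divide_distrib)
  then show ?thesis
    unfolding inner_field_wave by (simp add: mode_density_def)
qed

text \<open>Scalar product of the wave at \<open>x\<close> with the wave at \<open>y\<close> divided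
  by |k|, that is, with the inverse of \<open>mult_M\<close> applied to it.\<close>

definition overlap :: "(real \<Rightarrow> real) \<Rightarrow> (real \<Rightarrow> real) \<Rightarrow> real^3 \<Rightarrow> real^3 \<Rightarrow> real" where
  "overlap tr chi x y = (LINT k|lborel. mode_density chi k * tr (k \<bullet> x) * tr (k \<bullet> y))"

section \<open>Field part and energy of the fixed point for one fixed cutoff\<close>

lemma sin_cos_measurable:
  "(sin :: real \<Rightarrow> real) \<in> borel_measurable borel" "(cos :: real \<Rightarrow> real) \<in> borel_measurable borel"
  by (auto intro!: borel_measurable_continuous_onI continuous_at_imp_continuous_on)

locale radial_cutoff =
  fixes chi :: "real \<Rightarrow> real" and R :: real
  assumes cont: "continuous_on UNIV chi" and supp: "R < t \<Longrightarrow> chi t = 0"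
begin

lemma borel_measurable_chi [measurable]: "chi \<in> borel_measurable borel"
  using cont by (rule borel_measurable_continuous_onI)

lemma integrable_overlap:
  assumes "tr \<in> borel_measurable borel" "\<And>t. \<bar>tr t\<bar> \<le> 1"
  shows "integrable lborel (\<lambda>k. mode_density chi k * tr (k \<bullet> x) * tr (k \<bullet> y))"
  unfolding sum_field_wave_product[symmetric]
  using integrable_field_wave_product(2)[OF cont supp assms]
  by (intro Bochner_Integration.integrable_sum) blast

text \<open>The factor 1 / |k| in the solution is the one hidden in \<open>overlap\<close>. As
  \<open>q\<close> is known only almost everywhere, the integrands are compared in that sense before
  passing to \<open>lborel\<close>.\<close>

lemma field_inner_wave:
  fixes x :: "'n::finite \<Rightarrow> real^3"
  assumes tr: "tr \<in> borel_measurable borel" "\<And>t. \<bar>tr t\<bar> \<le> 1"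
    and q: "q \<in> field_space"
      "AE k in lebesgue. q k = (- h *\<^sub>R (\<Sum>i\<in>UNIV. w i *\<^sub>R field_wave tr chi (x i) k)) /\<^sub>R norm k"
  shows "field_inner (field_wave tr chi y) q = - h * (\<Sum>i\<in>UNIV. w i * overlap tr chi y (x i))"
proof -
  define P where "P j i k = field_wave tr chi y k $ j * field_wave tr chi (x i) k $ j / norm k" for j i k
  have P_meas [measurable]: "P j i \<in> borel_measurable borel" for i j
    unfolding P_def using tr(1) by measurable
  have P_int: "integrable lborel (P j i)" for i j
    unfolding P_def by (rule integrable_field_wave_product(2)[OF cont supp tr])
  have component: "(LINT k|lebesgue. field_wave tr chi y k $ j * q k $ j)
    = (\<Sum>i\<in>UNIV. (- h * w i) * (LINT k|lborel. P j i k))" for j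
  proof -
    have "(LINT k|lebesgue. field_wave tr chi y k $ j * q k $ j)
      = (LINT k|lebesgue. (\<Sum>i\<in>UNIV. (- h * w i) * P j i k))"
    proof (rule integral_cong_AE)
      have "(\<lambda>k. field_wave tr chi y k $ j) \<in> borel_measurable lebesgue"
        using tr(1) by (intro measurable_completion) simp
      moreover have "(\<lambda>k. q k $ j) \<in> borel_measurable lebesgue"
        using q(1) by (simp add: field_space_def)
      ultimately show "(\<lambda>k. field_wave tr chi y k $ j * q k $ j) \<in> borel_measurable lebesgue"
        by (rule borel_measurable_times)
      show "(\<lambda>k. \<Sum>i\<in>UNIV. (- h * w i) * P j i k) \<in> borel_measurable lebesgue"
        by (intro measurable_completion) simp
      show "AE k in lebesgue. field_wave tr chi y k $ j * q k $ j = (\<Sum>i\<in>UNIV. (- h * w i) * P j i k)"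
        using q(2)
      proof eventually_elim
        fix k
        assume q: "q k = (- h *\<^sub>R (\<Sum>i\<in>UNIV. w i *\<^sub>R field_wave tr chi (x i) k)) /\<^sub>R norm k"
        have "q k $ j = - h * (\<Sum>i\<in>UNIV. w i * field_wave tr chi (x i) k $ j) / norm k"
          unfolding q by (simp add: inverse_eq_divide)
        then show "field_wave tr chi y k $ j * q k $ j = (\<Sum>i\<in>UNIV. (- h * w i) * P j i k)"
          by (simp add: P_def sum_distrib_left sum_divide_distrib mult_ac)
      qed
    qed
    also have "\<dots> = (LINT k|lborel. (\<Sum>i\<in>UNIV. (- h * w i) * P j i k))"
      by (rule integral_completion) simp
    also have "\<dots> = (\<Sum>i\<in>UNIV. (- h * w i) * (LINT k|lborel. P j i k))"
      by (subst Bochner_Integration.integral_sum) (use P_int in simp_all)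
    finally show ?thesis .
  qed
  have "(\<Sum>j\<in>UNIV. LINT k|lborel. P j i k) = overlap tr chi y (x i)" for i
    unfolding overlap_def sum_field_wave_product[symmetric] P_def
    by (rule Bochner_Integration.integral_sum[symmetric]) (rule P_int[unfolded P_def])
  then have "(\<Sum>j\<in>UNIV. \<Sum>i\<in>UNIV. (- h * w i) * (LINT k|lborel. P j i k))
    = (\<Sum>i\<in>UNIV. (- h * w i) * overlap tr chi y (x i))"
    by (subst sum.swap) (simp only: flip: sum_distrib_left)
  then show ?thesis
    unfolding field_inner_def component by (simp add: sum_distrib_left mult.assoc)
qed

lemma norm_wave_sum:
  fixes x :: "'n::finite \<Rightarrow> real^3"
  shows "norm k * (norm ((- h *\<^sub>R (\<Sum>i\<in>UNIV. w i *\<^sub>R field_wave tr chi (x i) k)) /\<^sub>R norm k))\<^sup>2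
    = h\<^sup>2 * (\<Sum>l\<in>UNIV. \<Sum>i\<in>UNIV. w l * w i * (mode_density chi k * tr (k \<bullet> x l) * tr (k \<bullet> x i)))"
proof -
  define V where "V = (\<Sum>i\<in>UNIV. w i *\<^sub>R field_wave tr chi (x i) k)"
  define M where "M = (\<Sum>l\<in>UNIV. \<Sum>i\<in>UNIV. w l * w i * (mode_density chi k * tr (k \<bullet> x l) * tr (k \<bullet> x i)))"
  have "V \<bullet> V = norm k * M"
    unfolding V_def M_def inner_sum_left inner_sum_right inner_scaleR_left inner_scaleR_right
      inner_field_wave sum_distrib_left
    by (simp only: mult_ac)
  then have V: "(norm V)\<^sup>2 = norm k * M"
    by (simp add: power2_norm_eq_inner)
  have "norm k * (norm ((- h *\<^sub>R V) /\<^sub>R norm k))\<^sup>2 = norm k * (h\<^sup>2 * (norm V)\<^sup>2 / (norm k)\<^sup>2)"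
    by (simp add: power_mult_distrib inverse_eq_divide power_divide)
  also have "\<dots> = h\<^sup>2 * M"
  proof (cases "k = 0")
    \<comment> \<open>Both sides are 0 at the origin, where k_1 and k_2 vanish and with them
      \<open>mode_density\<close>.\<close>
    case True
    then have "M = 0"
      by (simp add: M_def mode_density_def)
    then show ?thesis
      using True by simp
  next
    case False
    then show ?thesis
      unfolding V by (simp add: power2_eq_square)
  qed
  finally show ?thesis
    by (simp add: V_def M_def)
qed

text \<open>The addition formula for the cosine makes the sum of the q and p contributions
  translation invariant; this is how \<open>F_eps\<close> of a difference of positions
  arises.\<close>

lemma overlap_sin_cos:
  "overlap sin chi x y + overlap cos chi x y = (LINT k|lborel. mode_density chi k * cos (k \<bullet> (x - y)))"
proof -
  have "overlap sin chi x y + overlap cos chi x y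
    = (LINT k|lborel. mode_density chi k * sin (k \<bullet> x) * sin (k \<bullet> y)
        + mode_density chi k * cos (k \<bullet> x) * cos (k \<bullet> y))"
    unfolding overlap_def
    by (rule Bochner_Integration.integral_add[symmetric]; rule integrable_overlap) (simp_all add: sin_cos_measurable)
  also have "\<dots> = (LINT k|lborel. mode_density chi k * cos (k \<bullet> (x - y)))"
    by (intro Bochner_Integration.integral_cong) (auto simp: inner_diff_right cos_diff algebra_simps)
  finally show ?thesis .
qed

lemma field_solution:
  fixes x :: "'n::finite \<Rightarrow> real^3" and w :: "'n \<Rightarrow> real" and h :: real
  assumes tr: "tr \<in> borel_measurable borel" "\<And>t. \<bar>tr t\<bar> \<le> 1"
  defines "G \<equiv> \<lambda>k. - h *\<^sub>R (\<Sum>i\<in>UNIV. w i *\<^sub>R field_wave tr chi (x i) k)"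
  defines "q \<equiv> SOME q. q \<in> field_space \<and> (AE k in lebesgue. mult_M q k = G k)"
  shows "q \<in> field_space" "AE k in lebesgue. q k = G k /\<^sub>R norm k"
proof -
  have "(\<lambda>k. G k $ j) \<in> borel_measurable borel" for j
    unfolding G_def using tr(1) by simp
  moreover have "integrable lborel (\<lambda>k. (G k $ j / norm k)\<^sup>2)" for j
  proof -
    \<comment> \<open>Expanding the square leaves finitely many products of two waves, which are
      integrable with the divisor |k|^2.\<close>
    have "(\<lambda>k. (G k $ j / norm k)\<^sup>2) = (\<lambda>k. \<Sum>l\<in>UNIV. \<Sum>i\<in>UNIV. (h\<^sup>2 * (w l * w i)) *
        (field_wave tr chi (x l) k $ j * field_wave tr chi (x i) k $ j / (norm k)\<^sup>2))"
    proof
      fix k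
      have "(G k $ j / norm k)\<^sup>2 = h\<^sup>2 * ((\<Sum>i\<in>UNIV. w i * field_wave tr chi (x i) k $ j)
        * (\<Sum>i\<in>UNIV. w i * field_wave tr chi (x i) k $ j)) / (norm k)\<^sup>2"
        by (simp add: G_def power_divide power_mult_distrib power2_eq_square[of "sum _ _"])
      also have "\<dots> = (\<Sum>l\<in>UNIV. \<Sum>i\<in>UNIV. (h\<^sup>2 * (w l * w i)) *
        (field_wave tr chi (x l) k $ j * field_wave tr chi (x i) k $ j / (norm k)\<^sup>2))"
        unfolding sum_product by (simp add: sum_distrib_left sum_divide_distrib mult_ac)
      finally show "(G k $ j / norm k)\<^sup>2 = (\<Sum>l\<in>UNIV. \<Sum>i\<in>UNIV. (h\<^sup>2 * (w l * w i)) *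
        (field_wave tr chi (x l) k $ j * field_wave tr chi (x i) k $ j / (norm k)\<^sup>2))" .
    qed
    then show ?thesis
      using integrable_field_wave_product(1)[OF cont supp tr]
      by (simp only:) (intro Bochner_Integration.integrable_sum integrable_mult_right)
  qed
  moreover have "k \<bullet> G k = 0" for k
    by (simp add: G_def inner_sum_right orthogonal_field_wave)
  ultimately show "q \<in> field_space" "AE k in lebesgue. q k = G k /\<^sub>R norm k"
    unfolding q_def by (rule some_field_solution)+
qed

text \<open>Let D be the double sum of overlaps. The field energy is +h^2 D / 2 and the coupling of
  the spins to the field is -h^2 D, since the field solves a linear equation with the spins as
  source; the total is -h^2 D / 2.\<close>

lemma fixed_point_energy_eq:
  fixes x :: "'n::finite \<Rightarrow> real^3" and w :: "'n \<Rightarrow> real"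
  assumes u: "\<And>m l. herm (sigma m l *v u) u = (if m = 3 then complex_of_real (w l) else 0)"
  shows "fixed_point_energy chi h \<beta> x u = h * \<beta> $ 3 * (\<Sum>l\<in>UNIV. w l)
    - h\<^sup>2 / 2 * (\<Sum>l\<in>UNIV. \<Sum>i\<in>UNIV. w l * w i * (LINT k|lborel. mode_density chi k * cos (k \<bullet> (x l - x i))))"
proof -
  have sum_w: "(\<Sum>l\<in>UNIV. \<Sum>m\<in>UNIV. Re (herm (sigma m l *v u) u) *\<^sub>R f m l)
    = (\<Sum>l\<in>UNIV. w l *\<^sub>R f 3 l)" for f :: "3 \<Rightarrow> 'n \<Rightarrow> real^3"
    by (simp add: sum_3 u)
  define q where "q = q_h chi h x u"
  define p where "p = p_h chi h x u"
  note trig = sin_cos_measurable abs_sin_le_one abs_cos_le_one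
  have q: "q \<in> field_space"
    "AE k in lebesgue. q k = (- h *\<^sub>R (\<Sum>i\<in>UNIV. w i *\<^sub>R field_wave sin chi (x i) k)) /\<^sub>R norm k"
    unfolding q_def q_h_def sum_w field_wave_sin[symmetric] by (rule field_solution[OF trig(1,3)])+
  have p: "p \<in> field_space"
    "AE k in lebesgue. p k = (- h *\<^sub>R (\<Sum>i\<in>UNIV. w i *\<^sub>R field_wave cos chi (x i) k)) /\<^sub>R norm k"
    unfolding p_def p_h_def sum_w field_wave_cos[symmetric] by (rule field_solution[OF trig(2,4)])+
  define S where "S l i = overlap sin chi (x l) (x i)" for l i
  define C where "C l i = overlap cos chi (x l) (x i)" for l i
  define A where "A tr k = (\<Sum>l\<in>UNIV. \<Sum>i\<in>UNIV. w l * w i * (mode_density chi k * tr (k \<bullet> x l) * tr (k \<bullet> x i)))"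
    for tr k
  have A_int: "integrable lborel (A sin)" "integrable lborel (A cos)"
    unfolding A_def
    by (intro Bochner_Integration.integrable_sum integrable_mult_right integrable_overlap trig)+
  have A_val: "(LINT k|lborel. A sin k) = (\<Sum>l\<in>UNIV. \<Sum>i\<in>UNIV. w l * w i * S l i)"
    "(LINT k|lborel. A cos k) = (\<Sum>l\<in>UNIV. \<Sum>i\<in>UNIV. w l * w i * C l i)"
    unfolding A_def S_def C_def overlap_def
    by (simp_all add: Bochner_Integration.integral_sum Bochner_Integration.integrable_sum
        integrable_mult_right integrable_overlap trig)
  have "(LINT k|lebesgue. norm k * ((norm (q k))\<^sup>2 + (norm (p k))\<^sup>2))
    = (LINT k|lebesgue. h\<^sup>2 * A sin k + h\<^sup>2 * A cos k)"
  proof (rule integral_cong_AE)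
    have [measurable]: "(\<lambda>k. q k $ j) \<in> borel_measurable lebesgue" "(\<lambda>k. p k $ j) \<in> borel_measurable lebesgue" for j
      using q(1) p(1) by (simp_all add: field_space_def)
    have [measurable]: "norm \<in> borel_measurable (lebesgue :: (real^3) measure)"
      by (intro measurable_completion) simp
    show "(\<lambda>k. norm k * ((norm (q k))\<^sup>2 + (norm (p k))\<^sup>2)) \<in> borel_measurable lebesgue"
      unfolding norm_vec3_sq by measurable
    show "(\<lambda>k. h\<^sup>2 * A sin k + h\<^sup>2 * A cos k) \<in> borel_measurable lebesgue"
      using A_int by (intro measurable_completion) (auto dest: borel_measurable_integrable)
    show "AE k in lebesgue. norm k * ((norm (q k))\<^sup>2 + (norm (p k))\<^sup>2) = h\<^sup>2 * A sin k + h\<^sup>2 * A cos k"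
      using q(2) p(2) by eventually_elim (simp only: norm_wave_sum distrib_left A_def)
  qed
  also have "\<dots> = (LINT k|lborel. h\<^sup>2 * A sin k + h\<^sup>2 * A cos k)"
    using A_int by (intro integral_completion) (auto dest: borel_measurable_integrable)
  also have "\<dots> = h\<^sup>2 * (LINT k|lborel. A sin k) + h\<^sup>2 * (LINT k|lborel. A cos k)"
    using A_int by simp
  finally have field: "(LINT k|lebesgue. norm k * ((norm (q k))\<^sup>2 + (norm (p k))\<^sup>2))
    = h\<^sup>2 * (\<Sum>l\<in>UNIV. \<Sum>i\<in>UNIV. w l * w i * (S l i + C l i))"
    unfolding A_val by (simp add: distrib_left sum.distrib)
  have B: "field_B chi 3 (x l) q p = - h * (\<Sum>i\<in>UNIV. w i * (S l i + C l i))" for l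
    unfolding field_B_def field_wave_sin[symmetric] field_wave_cos[symmetric]
      field_inner_wave[OF trig(1,3) q] field_inner_wave[OF trig(2,4) p] S_def C_def
    by (simp add: distrib_left sum.distrib)
  have spin: "(\<Sum>l\<in>UNIV. \<Sum>m\<in>UNIV. (\<beta> $ m + field_B chi m (x l) q p) * pi_fun u (i_sigma m l))
    = \<beta> $ 3 * (\<Sum>l\<in>UNIV. w l) - h * (\<Sum>l\<in>UNIV. \<Sum>i\<in>UNIV. w l * w i * (S l i + C l i))"
  proof -
    have "(\<Sum>l\<in>UNIV. \<Sum>m\<in>UNIV. (\<beta> $ m + field_B chi m (x l) q p) * pi_fun u (i_sigma m l))
      = (\<Sum>l\<in>UNIV. (\<beta> $ 3 + field_B chi 3 (x l) q p) * w l)"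
      by (simp add: sum_3 pi_fun_i_sigma u)
    also have "\<dots> = (\<Sum>l\<in>UNIV. \<beta> $ 3 * w l - h * (\<Sum>i\<in>UNIV. w l * w i * (S l i + C l i)))"
    proof (rule sum.cong[OF refl])
      fix l
      have "(\<Sum>i\<in>UNIV. w l * w i * (S l i + C l i)) = w l * (\<Sum>i\<in>UNIV. w i * (S l i + C l i))"
        by (simp only: sum_distrib_left mult.assoc)
      moreover have "(b + - h * T) * w l = b * w l - h * (w l * T)" for b T
        by (simp add: algebra_simps)
      ultimately show "(\<beta> $ 3 + field_B chi 3 (x l) q p) * w l
        = \<beta> $ 3 * w l - h * (\<Sum>i\<in>UNIV. w l * w i * (S l i + C l i))"
        unfolding B by (simp only:)
    qed
    finally show ?thesis
      by (simp add: sum_subtractf sum_distrib_left)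
  qed
  have SC: "S l i + C l i = (LINT k|lborel. mode_density chi k * cos (k \<bullet> (x l - x i)))" for l i
    unfolding S_def C_def by (rule overlap_sin_cos)
  show ?thesis
    unfolding fixed_point_energy_def hamiltonian_def q_def[symmetric] p_def[symmetric] field spin SC[symmetric]
    by (simp add: algebra_simps power2_eq_square)
qed

end

theorem mainTheorem11:
  fixes h :: real and \<beta> :: "real^3" and x :: "'n::finite \<Rightarrow> real^3"
    and \<phi> :: "real \<Rightarrow> real" and b0 b1 :: "complex^2" and E :: "'n set"
  assumes h: "h > 0"
    and beta: "\<beta> = vector [0, 0, norm \<beta>]" "\<beta> \<noteq> 0"
    and distinct: "inj x"
    and plane: "\<exists>c. \<forall>l. x l \<bullet> \<beta> = c"
    and phi: "smooth \<phi>" "compact (closure {t. \<phi> t \<noteq> 0})"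
      "eventually (\<lambda>t. \<phi> t = 1) (nhds 0)"
    and b0: "norm b0 = 1"
      "(\<Sum>m\<in>UNIV. complex_of_real (\<beta> $ m) *s (pauli m *v b0)) = - (complex_of_real (norm \<beta>) *s b0)"
    and b1: "norm b1 = 1"
      "(\<Sum>m\<in>UNIV. complex_of_real (\<beta> $ m) *s (pauli m *v b1)) = complex_of_real (norm \<beta>) *s b1"
  shows "((\<lambda>\<epsilon>. fixed_point_energy (\<lambda>r. \<phi> (\<epsilon> * r)) h \<beta> x (a_vec b0 b1 E)
              - (- (h\<^sup>2 / 2) * real CARD('n) * F_eps \<phi> \<epsilon> 0))
          \<longlongrightarrow> h * norm \<beta> * (\<Sum>l\<in>UNIV. eps_sign E l)
            + h\<^sup>2 / (8 * pi) *
              (\<Sum>l\<in>UNIV. \<Sum>j\<in>UNIV - {l}. eps_sign E l * eps_sign E j / (norm (x l - x j)) ^ 3))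
         (at_right 0)"
proof -
  have \<beta>: "\<beta> $ 1 = 0" "\<beta> $ 2 = 0" "\<beta> $ 3 = norm \<beta>"
    by (subst beta(1), simp)+
  define w where "w = eps_sign E"
  have w_sq: "w l * w l = 1" for l
    by (simp add: w_def eps_sign_def)
  have cont_\<phi>: "continuous_on UNIV \<phi>"
    using phi(1) by (rule smooth_imp_continuous)
  obtain \<psi>' \<psi>'' \<psi>''' \<delta> R where "cutoff (\<lambda>t. (\<phi> t)\<^sup>2) \<psi>' \<psi>'' \<psi>''' \<delta> R"
    using cutoff_square_exists[OF phi] by blast
  then have supp: "\<phi> t = 0" if "R \<le> t" for t
    using cutoff.supp(1) that by fastforce
  have energy: "fixed_point_energy (\<lambda>r. \<phi> (\<epsilon> * r)) h \<beta> x (a_vec b0 b1 E)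
      - (- (h\<^sup>2 / 2) * real CARD('n) * F_eps \<phi> \<epsilon> 0)
    = h * norm \<beta> * (\<Sum>l\<in>UNIV. w l)
      - h\<^sup>2 / 2 * (\<Sum>l\<in>UNIV. \<Sum>j\<in>UNIV - {l}. w l * w j * F_eps \<phi> \<epsilon> (x l - x j))"
    if \<epsilon>: "0 < \<epsilon>" for \<epsilon>
  proof -
    interpret radial_cutoff "\<lambda>r. \<phi> (\<epsilon> * r)" "R / \<epsilon>"
    proof
      show "continuous_on UNIV (\<lambda>r. \<phi> (\<epsilon> * r))"
        by (intro continuous_on_compose2[OF cont_\<phi>] continuous_on_mult_left continuous_on_id) simp
      show "\<phi> (\<epsilon> * t) = 0" if "R / \<epsilon> < t" for t
        using that \<epsilon> by (intro supp) (simp add: pos_divide_less_eq mult.commute)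
    qed
    have F: "(LINT k|lborel. mode_density (\<lambda>r. \<phi> (\<epsilon> * r)) k * cos (k \<bullet> y)) = F_eps \<phi> \<epsilon> y" for y
    proof -
      have "(LINT k|lborel. mode_density (\<lambda>r. \<phi> (\<epsilon> * r)) k * cos (k \<bullet> y))
        = (LINT k|lborel. 1 / (2 * pi) ^ 3 * ((\<phi> (\<epsilon> * norm k))\<^sup>2 * cos (k \<bullet> y)
            * (((k $ 1)\<^sup>2 + (k $ 2)\<^sup>2) / (norm k)\<^sup>2)))"
        by (rule Bochner_Integration.integral_cong) (simp_all add: mode_density_def)
      then show ?thesis
        unfolding F_eps_lborel[OF cont_\<phi>] by (simp only: integral_mult_right_zero)
    qed
    \<comment> \<open>The diagonal term loses its sign because \<open>w l * w l = 1\<close>; hence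
      the subtracted constant does not depend on \<open>E\<close>.\<close>
    have "(\<Sum>j\<in>UNIV. w l * w j * F_eps \<phi> \<epsilon> (x l - x j))
      = F_eps \<phi> \<epsilon> 0 + (\<Sum>j\<in>UNIV - {l}. w l * w j * F_eps \<phi> \<epsilon> (x l - x j))" for l
      by (subst sum.remove[of UNIV l]) (simp_all add: w_sq)
    then have "(\<Sum>l\<in>UNIV. \<Sum>j\<in>UNIV. w l * w j * F_eps \<phi> \<epsilon> (x l - x j))
      = real CARD('n) * F_eps \<phi> \<epsilon> 0 + (\<Sum>l\<in>UNIV. \<Sum>j\<in>UNIV - {l}. w l * w j * F_eps \<phi> \<epsilon> (x l - x j))"
      by (simp add: sum.distrib)
    moreover have "fixed_point_energy (\<lambda>r. \<phi> (\<epsilon> * r)) h \<beta> x (a_vec b0 b1 E)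
      = h * norm \<beta> * (\<Sum>l\<in>UNIV. w l)
        - h\<^sup>2 / 2 * (\<Sum>l\<in>UNIV. \<Sum>j\<in>UNIV. w l * w j * F_eps \<phi> \<epsilon> (x l - x j))"
      using fixed_point_energy_eq[OF herm_sigma_a_vec[OF beta b0 b1, where E = E, folded w_def], of h \<beta> x]
      unfolding F \<beta>(3) .
    ultimately show ?thesis
      by (simp add: algebra_simps)
  qed
  have pair: "((\<lambda>\<epsilon>. F_eps \<phi> \<epsilon> (x l - x j)) \<longlongrightarrow> - 1 / (4 * pi * norm (x l - x j) ^ 3)) (at_right 0)"
    if "j \<in> UNIV - {l}" for l j
  proof (rule F_eps_limit[OF phi])
    obtain c where "\<And>l. x l \<bullet> \<beta> = c"
      using plane by blast
    \<comment> \<open>Coplanarity enters only through differences: they are orthogonal to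
      \<open>\<beta>\<close>, hence to e_3, as \<open>F_eps_limit\<close> requires.\<close>
    then have "(x l - x j) \<bullet> \<beta> = 0"
      by (simp add: inner_diff_left)
    then show "(x l - x j) $ 3 = 0"
      using beta(2) by (simp add: inner_vec_def sum_3 \<beta>)
    show "x l - x j \<noteq> 0"
      using that distinct by (auto dest: injD)
  qed
  have "((\<lambda>\<epsilon>. h * norm \<beta> * (\<Sum>l\<in>UNIV. w l)
      - h\<^sup>2 / 2 * (\<Sum>l\<in>UNIV. \<Sum>j\<in>UNIV - {l}. w l * w j * F_eps \<phi> \<epsilon> (x l - x j)))
    \<longlongrightarrow> h * norm \<beta> * (\<Sum>l\<in>UNIV. w l)
      - h\<^sup>2 / 2 * (\<Sum>l\<in>UNIV. \<Sum>j\<in>UNIV - {l}. w l * w j * (- 1 / (4 * pi * norm (x l - x j) ^ 3))))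
    (at_right 0)"
    by (intro tendsto_diff tendsto_const tendsto_mult_left tendsto_sum pair)
  also have "h\<^sup>2 / 2 * (\<Sum>l\<in>UNIV. \<Sum>j\<in>UNIV - {l}. w l * w j * (- 1 / (4 * pi * norm (x l - x j) ^ 3)))
    = - (h\<^sup>2 / (8 * pi) * (\<Sum>l\<in>UNIV. \<Sum>j\<in>UNIV - {l}. w l * w j / norm (x l - x j) ^ 3))"
    by (simp add: sum_distrib_left sum_negf mult_ac)
  finally have "((\<lambda>\<epsilon>. h * norm \<beta> * (\<Sum>l\<in>UNIV. w l)
      - h\<^sup>2 / 2 * (\<Sum>l\<in>UNIV. \<Sum>j\<in>UNIV - {l}. w l * w j * F_eps \<phi> \<epsilon> (x l - x j)))
    \<longlongrightarrow> h * norm \<beta> * (\<Sum>l\<in>UNIV. w l)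
      + h\<^sup>2 / (8 * pi) * (\<Sum>l\<in>UNIV. \<Sum>j\<in>UNIV - {l}. w l * w j / norm (x l - x j) ^ 3))
    (at_right 0)"
    by simp
  then have "((\<lambda>\<epsilon>. fixed_point_energy (\<lambda>r. \<phi> (\<epsilon> * r)) h \<beta> x (a_vec b0 b1 E)
      - (- (h\<^sup>2 / 2) * real CARD('n) * F_eps \<phi> \<epsilon> 0))
    \<longlongrightarrow> h * norm \<beta> * (\<Sum>l\<in>UNIV. w l)
      + h\<^sup>2 / (8 * pi) * (\<Sum>l\<in>UNIV. \<Sum>j\<in>UNIV - {l}. w l * w j / norm (x l - x j) ^ 3)) (at_right 0)"
  proof (rule Lim_transform_eventually)
    show "\<forall>\<^sub>F \<epsilon> in at_right 0. h * norm \<beta> * (\<Sum>l\<in>UNIV. w l)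
        - h\<^sup>2 / 2 * (\<Sum>l\<in>UNIV. \<Sum>j\<in>UNIV - {l}. w l * w j * F_eps \<phi> \<epsilon> (x l - x j))
      = fixed_point_energy (\<lambda>r. \<phi> (\<epsilon> * r)) h \<beta> x (a_vec b0 b1 E)
        - (- (h\<^sup>2 / 2) * real CARD('n) * F_eps \<phi> \<epsilon> 0)"
      by (rule eventually_at_rightI[of 0 1]) (simp_all only: energy greaterThanLessThan_iff zero_less_one)
  qed
  then show ?thesis
    by (simp only: w_def)
qed

end
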